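(* Let $(X,d)$ be a compact quasihypermetric space. Then the following conditions are equivalent: (1) $M(X)<\infty$. (2) There exists a $d$-invariant sequence in $\mathcal{M}_1(X)$. (3) Some S-embedding of $X$ in the Hilbert space $\ell^2$ lies on a sphere. (4) Every S-embedding of $X$ in the Hilbert space $\ell^2$ lies on a sphere.
   Context: Metric spaces are non-empty. $(X,d)$ is quasihypermetric if $\sum_{i,j=1}^k\alpha_i\alpha_jd(x_i,x_j)\le 0$ for all $k\in\mathbb{N}$, all $x_1,\dots,x_k\in X$ and all real $\alpha_1,\dots,\alpha_k$ with $\sum_i\alpha_i=0$. For a compact metric space $(X,d)$: $\mathcal{M}_0(X)$, $\mathcal{M}_1(X)$ are the sets of finite signed Borel measures on $X$ of total mass $0$ and $1$ respectively; $I(\mu)=\int_X\int_X d(x,y)\,d\mu(x)\,d\mu(y)$; $M(X)=\sup\{I(\mu):\mu\in\mathcal{M}_1(X)\}$; $d_\mu(x)=\int_X d(x,y)\,d\mu(y)$, a function in $C(X)$ (continuous real functions with the sup-norm). When $X$ is quasihypermetric, $\mathcal{M}_0(X)$ carries the seminorm $\|\mu\|=[-I(\mu)]^{1/2}$. A sequence $(\mu_n)$ in $\mathcal{M}_1(X)$ is a $d$-invariant sequence (with value $c$) if $\|\mu_n-\mu_m\|\to 0$ as $n,m\to\infty$ and there is $c\in\mathbb{R}$ such that $d_{\mu_n}$ converges in $C(X)$ to the constant function $c$. An S-embedding of $X$ in $\ell^2$ (the real separable infinite-dimensional Hilbert space) is an isometric embedding of $(X,d^{1/2})$, i.e. a map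 $i\colon X\to\ell^2$ with $\|i(x)-i(y)\|^2=d(x,y)$ for all $x,y\in X$; it lies on a sphere if its image is contained in some set $\{y\in\ell^2:\|y-z\|=r\}$ with $z\in\ell^2$, $r\ge 0$. *)

theory Defs
  imports "HOL-Analysis.Analysis"
begin

typedef ell2 = "{f :: nat \<Rightarrow> real. summable (\<lambda>n. (f n)\<^sup>2)}"
  by (rule exI[of _ "\<lambda>_. 0"]) simp

setup_lifting type_definition_ell2

lemma summable_mult_ell2:
  fixes f g :: "nat \<Rightarrow> real"
  assumes "summable (\<lambda>n. (f n)\<^sup>2)" "summable (\<lambda>n. (g n)\<^sup>2)"
  shows "summable (\<lambda>n. f n * g n)"
proof (rule summable_comparison_test')
  show "summable (\<lambda>n. (f n)\<^sup>2 + (g n)\<^sup>2)"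
    using assms by (rule summable_add)
  fix n :: nat
  have "2 * \<bar>f n * g n\<bar> \<le> (f n)\<^sup>2 + (g n)\<^sup>2"
    using sum_squares_bound[of "\<bar>f n\<bar>" "\<bar>g n\<bar>"] by (simp add: abs_mult)
  then show "norm (f n * g n) \<le> (f n)\<^sup>2 + (g n)\<^sup>2"
    unfolding real_norm_def by linarith
qed

lemma summable_add_ell2:
  fixes f g :: "nat \<Rightarrow> real"
  assumes "summable (\<lambda>n. (f n)\<^sup>2)" "summable (\<lambda>n. (g n)\<^sup>2)"
  shows "summable (\<lambda>n. (f n + g n)\<^sup>2)"
  using summable_add[OF summable_add[OF assms] summable_mult[OF summable_mult_ell2[OF assms], of 2]]
  by (simp add: power2_sum mult.assoc)

instantiation ell2 :: real_inner
begin

lift_definition zero_ell2 :: ell2 is "\<lambda>_. 0" by simp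

lift_definition plus_ell2 :: "ell2 \<Rightarrow> ell2 \<Rightarrow> ell2" is "\<lambda>f g n. f n + g n"
  by (rule summable_add_ell2)

lift_definition uminus_ell2 :: "ell2 \<Rightarrow> ell2" is "\<lambda>f n. - f n" by simp

lift_definition minus_ell2 :: "ell2 \<Rightarrow> ell2 \<Rightarrow> ell2" is "\<lambda>f g n. f n - g n"
proof -
  fix f g :: "nat \<Rightarrow> real"
  assume "summable (\<lambda>n. (f n)\<^sup>2)" "summable (\<lambda>n. (g n)\<^sup>2)"
  then show "summable (\<lambda>n. (f n - g n)\<^sup>2)"
    using summable_add_ell2[of f "\<lambda>n. - g n"] by simp
qed

lift_definition scaleR_ell2 :: "real \<Rightarrow> ell2 \<Rightarrow> ell2" is "\<lambda>c f n. c * f n"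
  by (simp add: power_mult_distrib summable_mult)

lift_definition inner_ell2 :: "ell2 \<Rightarrow> ell2 \<Rightarrow> real" is "\<lambda>f g. \<Sum>n. f n * g n" .

definition norm_ell2 :: "ell2 \<Rightarrow> real" where "norm_ell2 x = sqrt (x \<bullet> x)"

definition dist_ell2 :: "ell2 \<Rightarrow> ell2 \<Rightarrow> real" where "dist_ell2 x y = norm (x - y)"

definition sgn_ell2 :: "ell2 \<Rightarrow> ell2" where "sgn_ell2 x = inverse (norm x) *\<^sub>R x"

definition uniformity_ell2 :: "(ell2 \<times> ell2) filter" where
  "uniformity_ell2 = (INF e\<in>{0<..}. principal {(x, y). dist x y < e})"

definition open_ell2 :: "ell2 set \<Rightarrow> bool" where
  "open_ell2 U = (\<forall>x\<in>U. eventually (\<lambda>(x', y). x' = x \<longrightarrow> y \<in> U) uniformity)"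

instance
proof
  fix x y z :: ell2 and a b :: real and U :: "ell2 set"
  show "x + y + z = x + (y + z)" by transfer (simp add: add.assoc)
  show "x + y = y + x" by transfer (simp add: add.commute)
  show "0 + x = x" by transfer simp
  show "- x + x = 0" by transfer simp
  show "x - y = x + - y" by transfer simp
  show "a *\<^sub>R (x + y) = a *\<^sub>R x + a *\<^sub>R y" by transfer (simp add: algebra_simps)
  show "(a + b) *\<^sub>R x = a *\<^sub>R x + b *\<^sub>R x" by transfer (simp add: algebra_simps)
  show "a *\<^sub>R b *\<^sub>R x = (a * b) *\<^sub>R x" by transfer (simp add: algebra_simps)
  show "1 *\<^sub>R x = x" by transfer simp
  show "dist x y = norm (x - y)" by (rule dist_ell2_def)
  show "sgn x = inverse (norm x) *\<^sub>R x" by (rule sgn_ell2_def)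
  show "uniformity = (INF e\<in>{0<..}. principal {(x, y :: ell2). dist x y < e})"
    by (rule uniformity_ell2_def)
  show "open U = (\<forall>x\<in>U. eventually (\<lambda>(x', y). x' = x \<longrightarrow> y \<in> U) uniformity)"
    by (rule open_ell2_def)
  show "x \<bullet> y = y \<bullet> x" by transfer (simp add: mult.commute)
  show "(x + y) \<bullet> z = x \<bullet> z + y \<bullet> z"
    by transfer (simp add: distrib_right suminf_add summable_mult_ell2)
  show "(a *\<^sub>R x) \<bullet> y = a * (x \<bullet> y)"
    by transfer (simp add: mult.assoc suminf_mult summable_mult_ell2)
  show "0 \<le> x \<bullet> x"
    by transfer (simp add: suminf_nonneg flip: power2_eq_square)
  show "x \<bullet> x = 0 \<longleftrightarrow> x = 0"
    by transfer (auto simp: suminf_eq_zero_iff fun_eq_iff simp flip: power2_eq_square)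
  show "norm x = sqrt (x \<bullet> x)" by (rule norm_ell2_def)
qed

end

lemma norm_ell2_eq: "(norm x)\<^sup>2 = (\<Sum>n. (Rep_ell2 x n)\<^sup>2)"
  unfolding power2_norm_eq_inner by transfer (simp add: power2_eq_square)

lemma sum_Rep_ell2_le: "(\<Sum>n<k. (Rep_ell2 x n)\<^sup>2) \<le> (norm x)\<^sup>2"
  unfolding norm_ell2_eq using Rep_ell2[of x] by (intro sum_le_suminf) auto

lemma abs_Rep_ell2_le: "\<bar>Rep_ell2 x n\<bar> \<le> norm x"
proof -
  have "(Rep_ell2 x n)\<^sup>2 \<le> (\<Sum>i<Suc n. (Rep_ell2 x i)\<^sup>2)"
    by (simp add: sum_nonneg)
  also have "\<dots> \<le> (norm x)\<^sup>2"
    by (rule sum_Rep_ell2_le)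
  finally show ?thesis
    using abs_le_square_iff[of "Rep_ell2 x n" "norm x"] by simp
qed

instance ell2 :: complete_space
proof
  fix X :: "nat \<Rightarrow> ell2"
  assume "Cauchy X"
  have Rep_diff: "Rep_ell2 (x - y) n = Rep_ell2 x n - Rep_ell2 y n" for x y n
    by transfer simp
  have "Cauchy (\<lambda>m. Rep_ell2 (X m) n)" for n
  proof (rule CauchyI)
    fix e :: real assume "0 < e"
    then obtain M where "\<forall>m\<ge>M. \<forall>n\<ge>M. norm (X m - X n) < e"
      using CauchyD[OF \<open>Cauchy X\<close>] by blast
    moreover have "norm (Rep_ell2 (X m) n - Rep_ell2 (X k) n) \<le> norm (X m - X k)" for m k
      using abs_Rep_ell2_le[of "X m - X k" n] by (simp add: Rep_diff)
    ultimately show "\<exists>M. \<forall>m\<ge>M. \<forall>k\<ge>M. norm (Rep_ell2 (X m) n - Rep_ell2 (X k) n) < e"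
      by (blast intro: le_less_trans)
  qed
  then obtain f where f: "(\<lambda>m. Rep_ell2 (X m) n) \<longlonglongrightarrow> f n" for n
    unfolding Cauchy_convergent_iff convergent_def by metis
  have tail: "\<exists>M. \<forall>m\<ge>M. \<forall>k. (\<Sum>n<k. (Rep_ell2 (X m) n - f n)\<^sup>2) \<le> e\<^sup>2" if e: "0 < e" for e
  proof -
    obtain M where M: "\<forall>m\<ge>M. \<forall>n\<ge>M. norm (X m - X n) < e"
      using CauchyD[OF \<open>Cauchy X\<close> e] by blast
    have "(\<Sum>n<k. (Rep_ell2 (X m) n - f n)\<^sup>2) \<le> e\<^sup>2" if "m \<ge> M" for m k
    proof (rule LIMSEQ_le_const2)
      show "(\<lambda>l. \<Sum>n<k. (Rep_ell2 (X m) n - Rep_ell2 (X l) n)\<^sup>2)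
        \<longlonglongrightarrow> (\<Sum>n<k. (Rep_ell2 (X m) n - f n)\<^sup>2)"
        by (intro tendsto_intros f)
      have "(\<Sum>n<k. (Rep_ell2 (X m) n - Rep_ell2 (X l) n)\<^sup>2) \<le> e\<^sup>2" if "l \<ge> M" for l
      proof -
        have "norm (X m - X l) \<le> e"
          using M \<open>m \<ge> M\<close> that by (simp add: less_imp_le)
        then have "(norm (X m - X l))\<^sup>2 \<le> e\<^sup>2"
          by (intro power_mono) auto
        with sum_Rep_ell2_le[of "X m - X l" k] show ?thesis
          unfolding Rep_diff by linarith
      qed
      then show "\<exists>N. \<forall>l\<ge>N. (\<Sum>n<k. (Rep_ell2 (X m) n - Rep_ell2 (X l) n)\<^sup>2) \<le> e\<^sup>2"
        by blast
    qed
    then show ?thesis by blast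
  qed
  obtain M1 where M1: "(\<Sum>n<k. (Rep_ell2 (X M1) n - f n)\<^sup>2) \<le> 1\<^sup>2" for k
    using tail[OF zero_less_one] by blast
  have "summable (\<lambda>n. (Rep_ell2 (X M1) n - f n)\<^sup>2)"
    by (rule summableI_nonneg_bounded[OF _ M1]) simp
  then have "summable (\<lambda>n. (f n - Rep_ell2 (X M1) n)\<^sup>2)"
    by (subst power2_commute)
  from summable_add_ell2[OF this, of "Rep_ell2 (X M1)"] Rep_ell2[of "X M1"]
  have f2: "summable (\<lambda>n. (f n)\<^sup>2)" by simp
  define L where "L = Abs_ell2 f"
  have L: "Rep_ell2 L = f"
    using f2 by (simp add: L_def Abs_ell2_inverse)
  have "X \<longlonglongrightarrow> L"
  proof (rule LIMSEQ_I)
    fix e :: real assume "0 < e"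
    then obtain M where M: "\<forall>m\<ge>M. \<forall>k. (\<Sum>n<k. (Rep_ell2 (X m) n - f n)\<^sup>2) \<le> (e/2)\<^sup>2"
      using tail[of "e/2"] half_gt_zero by blast
    have "norm (X m - L) < e" if "m \<ge> M" for m
    proof -
      have "(norm (X m - L))\<^sup>2 \<le> (e/2)\<^sup>2"
        unfolding norm_ell2_eq using M that Rep_ell2[of "X m - L"]
        by (intro suminf_le_const) (auto simp: Rep_diff L)
      then have "norm (X m - L) \<le> e/2"
        by (rule power2_le_imp_le) (use \<open>0 < e\<close> in simp)
      then show ?thesis using \<open>0 < e\<close> by simp
    qed
    then show "\<exists>no. \<forall>n\<ge>no. norm (X n - L) < e" by blast
  qed
  then show "convergent X" by (auto simp: convergent_def)
qed

definition S_embedding :: "'a::metric_space set \<Rightarrow> ('a \<Rightarrow> ell2) \<Rightarrow> bool" where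
  "S_embedding X i \<longleftrightarrow> (\<forall>x\<in>X. \<forall>y\<in>X. (norm (i x - i y))\<^sup>2 = dist x y)"

definition lies_on_sphere :: "'a set \<Rightarrow> ('a \<Rightarrow> ell2) \<Rightarrow> bool" where
  "lies_on_sphere X i \<longleftrightarrow> (\<exists>z r. 0 \<le> r \<and> i ` X \<subseteq> sphere z r)"

definition quasihypermetric :: "'a::metric_space set \<Rightarrow> bool" where
  "quasihypermetric X \<longleftrightarrow>
    (\<forall>(k::nat) (x :: nat \<Rightarrow> 'a) (\<alpha> :: nat \<Rightarrow> real).
      (\<forall>i<k. x i \<in> X) \<and> (\<Sum>i<k. \<alpha> i) = 0 \<longrightarrow>
      (\<Sum>i<k. \<Sum>j<k. \<alpha> i * \<alpha> j * dist (x i) (x j)) \<le> 0)"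

text \<open>
  A finite signed measure on the measurable space \<open>M\<close> is a countably additive real-valued set
  function on \<open>sets M\<close>; it is required to vanish on non-measurable sets only so that equality
  of set functions is equality of signed measures. (The measure stored in \<open>M\<close> plays no role.)
\<close>

definition signed_measures :: "'a measure \<Rightarrow> ('a set \<Rightarrow> real) set" where
  "signed_measures M = {\<mu>. \<mu> {} = 0 \<and> (\<forall>A. A \<notin> sets M \<longrightarrow> \<mu> A = 0) \<and>
    (\<forall>A :: nat \<Rightarrow> 'a set. range A \<subseteq> sets M \<longrightarrow> disjoint_family A \<longrightarrow>
      (\<lambda>n. \<mu> (A n)) sums \<mu> (\<Union>n. A n))}"

text \<open>
  The positive variation \<open>\<mu>\<^sup>+(A) = sup {\<mu>(B) | B \<subseteq> A}\<close>. The coercion \<open>ennreal\<close> sends negative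
  reals to \<open>0\<close>, which does not change the supremum because \<open>B = {}\<close> is admitted.
\<close>

definition pos_variation :: "'a measure \<Rightarrow> ('a set \<Rightarrow> real) \<Rightarrow> 'a measure" where
  "pos_variation M \<mu> =
    measure_of (space M) (sets M) (\<lambda>A. SUP B\<in>{B \<in> sets M. B \<subseteq> A}. ennreal (\<mu> B))"

definition neg_variation :: "'a measure \<Rightarrow> ('a set \<Rightarrow> real) \<Rightarrow> 'a measure" where
  "neg_variation M \<mu> = pos_variation M (\<lambda>A. - \<mu> A)"

definition signed_integral :: "'a measure \<Rightarrow> ('a set \<Rightarrow> real) \<Rightarrow> ('a \<Rightarrow> real) \<Rightarrow> real" where
  "signed_integral M \<mu> f =
    integral\<^sup>L (pos_variation M \<mu>) f - integral\<^sup>L (neg_variation M \<mu>) f"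

abbreviation borel_on :: "'a::topological_space set \<Rightarrow> 'a measure" where
  "borel_on X \<equiv> restrict_space borel X"

definition mass_measures :: "'a::metric_space set \<Rightarrow> real \<Rightarrow> ('a set \<Rightarrow> real) set" where
  "mass_measures X t = {\<mu> \<in> signed_measures (borel_on X). \<mu> X = t}"

definition potential :: "'a::metric_space set \<Rightarrow> ('a set \<Rightarrow> real) \<Rightarrow> 'a \<Rightarrow> real" where
  "potential X \<mu> x = signed_integral (borel_on X) \<mu> (\<lambda>y. dist x y)"

definition energy :: "'a::metric_space set \<Rightarrow> ('a set \<Rightarrow> real) \<Rightarrow> real" where
  "energy X \<mu> =
    signed_integral (borel_on X) \<mu> (\<lambda>y. signed_integral (borel_on X) \<mu> (\<lambda>x. dist x y))"

definition max_energy :: "'a::metric_space set \<Rightarrow> ereal" where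
  "max_energy X = (SUP \<mu>\<in>mass_measures X 1. ereal (energy X \<mu>))"

definition energy_seminorm :: "'a::metric_space set \<Rightarrow> ('a set \<Rightarrow> real) \<Rightarrow> real" where
  "energy_seminorm X \<mu> = sqrt (- energy X \<mu>)"

definition d_invariant_seq :: "'a::metric_space set \<Rightarrow> (nat \<Rightarrow> 'a set \<Rightarrow> real) \<Rightarrow> bool" where
  "d_invariant_seq X \<mu> \<longleftrightarrow>
    range \<mu> \<subseteq> mass_measures X 1 \<and>
    ((\<lambda>(n, m). energy_seminorm X (\<lambda>A. \<mu> n A - \<mu> m A)) \<longlongrightarrow> 0)
      (sequentially \<times>\<^sub>F sequentially) \<and>
    (\<exists>c. uniform_limit X (\<lambda>n. potential X (\<mu> n)) (\<lambda>_. c) sequentially)"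

end

theory Submission
  imports Defs
begin

text \<open>
  Over finer and finer Borel partitions of \<open>X\<close>, energies are limits of energies of finite
  configurations of point masses, so bilinearity, symmetry and negativity on mass \<open>0\<close> pass from
  finite sums to signed measures. If the energy is bounded above on mass \<open>1\<close>, a maximising sequence
  of finite configurations is Cauchy by the parallelogram law, and comparing its members with point
  masses shows that their potentials become constant. Under an S-embedding its barycentres converge
  to the centre of a sphere containing the image of \<open>X\<close>. Conversely, an embedding on a sphere of
  radius \<open>r\<close> bounds all energies by \<open>2 r\<^sup>2\<close>, and a \<open>d\<close>-invariant sequence bounds them because
  differences of measures of mass \<open>1\<close> have nonpositive energy. S-embeddings exist by Cholesky
  elimination of the kernel \<open>(d(x,q) + d(y,q) - d(x,y)) / 2\<close> along a dense sequence.
\<close>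

section \<open>Finite signed measures\<close>

text \<open>Nothing bounds the total variation of near-maximisers, so weak compactness yields no
  maximising measure. Completeness of \<open>ell2\<close> replaces it: what converges is the
  barycentres, and the limit is a centre rather than a measure. Working with finite configurations
  keeps barycentres finite sums, so no vector-valued integral occurs. A second obstacle is that the
  positive and negative variations are not additive in the measure, so
  \<open>signed_integral\<close> is not visibly linear in \<mu>. Cell values
  \<open>\<mu> (P k i)\<close> are linear in \<mu>, and finite double sums can be swapped freely;
  this is why energies are discretised instead of manipulated as iterated integrals. The constants
  match: on a sphere of centre c and radius r, a configuration of mass 1 with barycentre b has
  energy \<open>2 * r\<^sup>2 - 2 * (norm (b - c))\<^sup>2\<close>, and the sphere constructed from
  the supremum M has squared radius M / 2.\<close>

lemma signed_measures_empty: "\<mu> \<in> signed_measures M \<Longrightarrow> \<mu> {} = 0"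
  by (simp add: signed_measures_def)

lemma signed_measures_sums:
  "\<mu> \<in> signed_measures M \<Longrightarrow> range A \<subseteq> sets M \<Longrightarrow> disjoint_family A \<Longrightarrow>
    (\<lambda>n. \<mu> (A n)) sums \<mu> (\<Union>n. A n)"
  by (simp add: signed_measures_def)

lemma signed_measures_Un:
  assumes "\<mu> \<in> signed_measures M" "A \<in> sets M" "B \<in> sets M" "A \<inter> B = {}"
  shows "\<mu> (A \<union> B) = \<mu> A + \<mu> B"
proof -
  have "(\<lambda>n. \<mu> (binaryset A B n)) sums \<mu> (\<Union>n. binaryset A B n)"
    using assms by (intro signed_measures_sums)
      (auto simp: binaryset_def disjoint_family_on_def)
  moreover have "(\<lambda>n. \<mu> (binaryset A B n)) sums (\<mu> A + \<mu> B)"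
    using assms by (intro binaryset_sums) (simp add: signed_measures_empty)
  ultimately show ?thesis
    by (simp add: UN_binaryset_eq sums_unique2)
qed

lemma signed_measures_Diff:
  assumes "\<mu> \<in> signed_measures M" "A \<in> sets M" "B \<in> sets M" "B \<subseteq> A"
  shows "\<mu> (A - B) = \<mu> A - \<mu> B"
  using signed_measures_Un[of \<mu> M B "A - B"] assms by (simp add: Un_absorb1)

lemma signed_measures_finite_UN:
  fixes n :: nat
  assumes "\<mu> \<in> signed_measures M" "\<And>i. i < n \<Longrightarrow> A i \<in> sets M" "disjoint_family_on A {..<n}"
  shows "\<mu> (\<Union>i<n. A i) = (\<Sum>i<n. \<mu> (A i))"
  using assms(2,3)
proof (induction n)
  case 0
  then show ?case using assms(1) by (simp add: signed_measures_empty)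
next
  case (Suc n)
  have "A i \<inter> A n = {}" if "i < n" for i
    using that by (intro disjoint_family_onD[OF Suc.prems(2)]) auto
  then have "(\<Union>i<n. A i) \<inter> A n = {}" by auto
  then have "\<mu> ((\<Union>i<n. A i) \<union> A n) = \<mu> (\<Union>i<n. A i) + \<mu> (A n)"
    using Suc.prems by (intro signed_measures_Un[OF assms(1)]) auto
  moreover have "\<mu> (\<Union>i<n. A i) = (\<Sum>i<n. \<mu> (A i))"
    using Suc.prems by (intro Suc.IH) (auto simp: disjoint_family_on_def)
  ultimately show ?case
    by (simp add: lessThan_Suc Un_commute)
qed

lemma signed_measures_lin_comb:
  assumes "\<mu> \<in> signed_measures M" "\<nu> \<in> signed_measures M"
  shows "(\<lambda>A. a * \<mu> A + b * \<nu> A) \<in> signed_measures M"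
  using assms unfolding signed_measures_def
  by (auto intro!: sums_add sums_mult)

lemma signed_measures_uminus:
  "\<mu> \<in> signed_measures M \<Longrightarrow> (\<lambda>A. - \<mu> A) \<in> signed_measures M"
  using signed_measures_lin_comb[of \<mu> M \<mu> "-1" 0] by simp

section \<open>Variations and the Jordan decomposition\<close>

definition upper_variation :: "'a measure \<Rightarrow> ('a set \<Rightarrow> real) \<Rightarrow> 'a set \<Rightarrow> ennreal" where
  "upper_variation M \<mu> A = (SUP B\<in>{B \<in> sets M. B \<subseteq> A}. ennreal (\<mu> B))"

lemma le_upper_variation:
  "B \<in> sets M \<Longrightarrow> B \<subseteq> A \<Longrightarrow> ennreal (\<mu> B) \<le> upper_variation M \<mu> A"
  unfolding upper_variation_def by (rule SUP_upper) auto

lemma upper_variation_mono: "A \<subseteq> B \<Longrightarrow> upper_variation M \<mu> A \<le> upper_variation M \<mu> B"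
  unfolding upper_variation_def by (rule SUP_subset_mono) auto

lemma upper_variation_empty: "\<mu> \<in> signed_measures M \<Longrightarrow> upper_variation M \<mu> {} = 0"
  unfolding upper_variation_def
  by (auto simp: signed_measures_empty bot_ennreal intro!: antisym SUP_least)

lemma upper_variation_superadditive:
  assumes "\<mu> \<in> signed_measures M" "A \<inter> B = {}"
  shows "upper_variation M \<mu> A + upper_variation M \<mu> B \<le> upper_variation M \<mu> (A \<union> B)"
proof -
  have *: "ennreal (\<mu> C) + ennreal (\<mu> D) \<le> upper_variation M \<mu> (A \<union> B)"
    if "C \<in> sets M" "C \<subseteq> A" "D \<in> sets M" "D \<subseteq> B" for C D
  proof -
    \<comment> \<open>\<open>ennreal\<close> is additive only on nonnegative reals. A nonpositive
      summand is truncated to 0, and then the other set alone is a sufficient competitor.\<close>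
    consider "\<mu> C \<le> 0" | "\<mu> D \<le> 0" | "\<mu> C \<ge> 0" "\<mu> D \<ge> 0" by linarith
    then show ?thesis
    proof cases
      case 1
      then show ?thesis
        using le_upper_variation[of D M "A \<union> B" \<mu>] that by (auto simp: ennreal_neg)
    next
      case 2
      then show ?thesis
        using le_upper_variation[of C M "A \<union> B" \<mu>] that by (auto simp: ennreal_neg)
    next
      case 3
      have "\<mu> (C \<union> D) = \<mu> C + \<mu> D"
        using that assms by (intro signed_measures_Un) auto
      then show ?thesis
        using le_upper_variation[of "C \<union> D" M "A \<union> B" \<mu>] that 3
        by (auto simp: ennreal_plus[symmetric] simp del: ennreal_plus)
    qed
  qed
  have ne: "{B \<in> sets M. B \<subseteq> A} \<noteq> {}" "{C \<in> sets M. C \<subseteq> B} \<noteq> {}" for A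
    by auto
  show ?thesis
    unfolding upper_variation_def[of M \<mu> A] upper_variation_def[of M \<mu> B]
      ennreal_SUP_add_left[OF ne(1), symmetric]
    by (rule SUP_least, subst ennreal_SUP_add_right[OF ne(2)], rule SUP_least)
      (use * in auto)
qed

text \<open>Superadditivity on finite unions gives one inequality in the limit. For the other, a
  competitor B is cut into the pieces \<open>B \<inter> A i\<close>, each a competitor inside
  \<open>A i\<close>.\<close>

lemma upper_variation_countably_additive:
  assumes \<mu>: "\<mu> \<in> signed_measures M"
  shows "countably_additive (sets M) (upper_variation M \<mu>)"
proof (rule countably_additiveI)
  fix A :: "nat \<Rightarrow> 'a set"
  assume A: "range A \<subseteq> sets M" "disjoint_family A"
  have fin: "(\<Sum>i<n. upper_variation M \<mu> (A i)) \<le> upper_variation M \<mu> (\<Union>i<n. A i)" for n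
  proof (induction n)
    case (Suc n)
    have "A i \<inter> A n = {}" if "i < n" for i
      using that by (intro disjoint_family_onD[OF A(2)]) auto
    then have "(\<Union>i<n. A i) \<inter> A n = {}" by auto
    from add_right_mono[OF Suc] upper_variation_superadditive[OF \<mu> this]
    have "(\<Sum>i<n. upper_variation M \<mu> (A i)) + upper_variation M \<mu> (A n) \<le>
        upper_variation M \<mu> ((\<Union>i<n. A i) \<union> A n)"
      by (rule order_trans)
    then show ?case
      by (simp add: lessThan_Suc Un_commute add.commute)
  qed simp
  have "(\<Sum>i. upper_variation M \<mu> (A i)) \<le> upper_variation M \<mu> (\<Union>i. A i)"
    unfolding suminf_eq_SUP
    by (rule SUP_least, rule order_trans[OF fin upper_variation_mono]) auto
  moreover have "upper_variation M \<mu> (\<Union>i. A i) \<le> (\<Sum>i. upper_variation M \<mu> (A i))"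
    unfolding upper_variation_def[of M \<mu> "\<Union>i. A i"]
  proof (rule SUP_least, safe)
    fix B assume B: "B \<in> sets M" "B \<subseteq> (\<Union>i. A i)"
    have "(\<lambda>i. \<mu> (B \<inter> A i)) sums \<mu> (\<Union>i. B \<inter> A i)"
      using A B by (intro signed_measures_sums[OF \<mu>]) (auto simp: disjoint_family_on_def)
    moreover have "(\<Union>i. B \<inter> A i) = B" using B by auto
    ultimately have "(\<lambda>n. ennreal (\<Sum>i<n. \<mu> (B \<inter> A i))) \<longlonglongrightarrow> ennreal (\<mu> B)"
      by (intro tendsto_ennrealI) (simp add: sums_def)
    moreover have "ennreal (\<Sum>i<n. \<mu> (B \<inter> A i)) \<le> (\<Sum>i. upper_variation M \<mu> (A i))" for n
    proof -
      \<comment> \<open>Negative terms still count inside \<open>ennreal\<close> of the whole sum.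
        Raising them to 0 only increases it and lets \<open>ennreal\<close> commute with the
        sum.\<close>
      have "ennreal (\<Sum>i<n. \<mu> (B \<inter> A i)) \<le> ennreal (\<Sum>i<n. max 0 (\<mu> (B \<inter> A i)))"
        by (intro ennreal_leI sum_mono) auto
      also have "\<dots> = (\<Sum>i<n. ennreal (\<mu> (B \<inter> A i)))"
        by (subst sum_ennreal[symmetric]) (auto simp: ennreal_max_0 intro!: sum.cong)
      also have "\<dots> \<le> (\<Sum>i<n. upper_variation M \<mu> (A i))"
        using A B by (intro sum_mono le_upper_variation) auto
      also have "\<dots> \<le> (\<Sum>i. upper_variation M \<mu> (A i))"
        by (intro sum_le_suminf) auto
      finally show ?thesis .
    qed
    ultimately show "ennreal (\<mu> B) \<le> (\<Sum>i. upper_variation M \<mu> (A i))"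
      by - (rule LIMSEQ_le_const2, assumption, blast)
  qed
  ultimately show "(\<Sum>i. upper_variation M \<mu> (A i)) = upper_variation M \<mu> (\<Union>i. A i)"
    by (rule antisym)
qed

lemma sets_pos_variation [measurable_cong, simp]: "sets (pos_variation M \<mu>) = sets M"
  by (simp add: pos_variation_def)

lemma space_pos_variation [simp]: "space (pos_variation M \<mu>) = space M"
  by (simp add: pos_variation_def)

lemma sets_neg_variation [measurable_cong, simp]: "sets (neg_variation M \<mu>) = sets M"
  by (simp add: neg_variation_def)

lemma space_neg_variation [simp]: "space (neg_variation M \<mu>) = space M"
  by (simp add: neg_variation_def)

text \<open>\<open>measure_of\<close> yields the null measure for a set function that is not
  countably additive, so the supremum formula becomes available only now.\<close>

lemma emeasure_pos_variation:
  assumes "\<mu> \<in> signed_measures M" "A \<in> sets M"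
  shows "emeasure (pos_variation M \<mu>) A = upper_variation M \<mu> A"
  unfolding pos_variation_def upper_variation_def[symmetric]
  using assms upper_variation_countably_additive[OF assms(1)]
  by (intro emeasure_measure_of_sigma sets.sigma_algebra_axioms)
     (auto simp: positive_def upper_variation_empty)

lemma emeasure_neg_variation:
  assumes "\<mu> \<in> signed_measures M" "A \<in> sets M"
  shows "emeasure (neg_variation M \<mu>) A = upper_variation M (\<lambda>A. - \<mu> A) A"
  unfolding neg_variation_def
  by (rule emeasure_pos_variation[OF signed_measures_uminus[OF assms(1)] assms(2)])

text \<open>
  A set of infinite variation splits into a set on which \<open>\<mu>\<close> exceeds \<open>1\<close> in absolute value and
  a set that again has infinite variation. Iterating this would produce a disjoint family on
  which \<open>\<mu>\<close> is not summable.
\<close>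

lemma signed_measures_finite_variation:
  assumes \<mu>: "\<mu> \<in> signed_measures M"
  shows "emeasure (pos_variation M \<mu>) (space M) + emeasure (neg_variation M \<mu>) (space M) < \<infinity>"
proof (rule ccontr)
  define V where "V A = emeasure (pos_variation M \<mu>) A + emeasure (neg_variation M \<mu>) A" for A
  assume "\<not> ?thesis"
  then have V0: "V (space M) = \<infinity>"
    unfolding V_def[symmetric] by (metis infinity_ennreal_def less_top)
  have large: "\<exists>B\<in>sets M. B \<subseteq> E \<and> \<bar>\<mu> B\<bar> > C" if E: "E \<in> sets M" "V E = \<infinity>" and "C \<ge> 0" for E C
  proof (rule ccontr)
    assume "\<not> ?thesis"
    then have "\<bar>\<mu> B\<bar> \<le> C" if "B \<in> sets M" "B \<subseteq> E" for B
      using that by force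
    then have "upper_variation M \<mu> E \<le> ennreal C"
      "upper_variation M (\<lambda>A. - \<mu> A) E \<le> ennreal C"
      unfolding upper_variation_def by (auto intro!: SUP_least ennreal_leI simp: abs_le_iff)
    then have "V E \<le> ennreal C + ennreal C"
      unfolding V_def emeasure_pos_variation[OF \<mu> E(1)] emeasure_neg_variation[OF \<mu> E(1)]
      by (rule add_mono)
    also have "\<dots> < \<infinity>" by simp
    finally show False using E by simp
  qed
  have step: "\<exists>F. F \<in> sets M \<and> V F = \<infinity> \<and> F \<subseteq> E \<and> \<bar>\<mu> (E - F)\<bar> > 1"
    if E: "E \<in> sets M" "V E = \<infinity>" for E
  proof -
    \<comment> \<open>The threshold makes both \<open>\<bar>\<mu> B\<bar>\<close> and
      \<open>\<bar>\<mu> E - \<mu> B\<bar>\<close> exceed 1, so whichever half has infinite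
      variation, the other can be split off.\<close>
    obtain B where B: "B \<in> sets M" "B \<subseteq> E" "\<bar>\<mu> B\<bar> > 1 + \<bar>\<mu> E\<bar>"
      using large[OF E, of "1 + \<bar>\<mu> E\<bar>"] by auto
    have d: "\<mu> (E - B) = \<mu> E - \<mu> B"
      using signed_measures_Diff[OF \<mu> E(1) B(1,2)] .
    have "V B + V (E - B) = V (B \<union> (E - B))"
      unfolding V_def using E B
      by (subst (1 2) plus_emeasure[symmetric]) (auto simp: algebra_simps)
    also have "B \<union> (E - B) = E" using B by auto
    finally have "V B = \<infinity> \<or> V (E - B) = \<infinity>"
      using E by (simp add: ennreal_add_eq_top)
    then show ?thesis
    proof
      assume "V B = \<infinity>"
      then show ?thesis using B E d by (intro exI[of _ B]) auto
    next
      assume "V (E - B) = \<infinity>"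
      moreover have "E - (E - B) = B" using B by auto
      ultimately show ?thesis using B E by (intro exI[of _ "E - B"]) auto
    qed
  qed
  then obtain next_set where nx: "\<And>E. E \<in> sets M \<Longrightarrow> V E = \<infinity> \<Longrightarrow>
      next_set E \<in> sets M \<and> V (next_set E) = \<infinity> \<and> next_set E \<subseteq> E \<and> \<bar>\<mu> (E - next_set E)\<bar> > 1"
    by metis
  define F where "F n = (next_set ^^ n) (space M)" for n
  have F: "F n \<in> sets M \<and> V (F n) = \<infinity>" for n
    by (induction n) (use V0 nx in \<open>auto simp: F_def\<close>)
  have FS: "F (Suc n) \<subseteq> F n" "\<bar>\<mu> (F n - F (Suc n))\<bar> > 1" for n
    using nx[of "F n"] F[of n] by (auto simp: F_def)
  have anti: "F n \<subseteq> F m" if "m \<le> n" for m n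
    using that FS(1) by (rule lift_Suc_antimono_le[rotated])
  have "disjoint_family (\<lambda>n. F n - F (Suc n))"
    unfolding disjoint_family_on_def
  proof (intro ballI impI)
    fix m n :: nat assume "m \<noteq> n"
    then consider "Suc m \<le> n" | "Suc n \<le> m" by linarith
    then show "(F m - F (Suc m)) \<inter> (F n - F (Suc n)) = {}"
      using anti[of "Suc m" n] anti[of "Suc n" m] by cases auto
  qed
  then have "(\<lambda>n. \<mu> (F n - F (Suc n))) sums \<mu> (\<Union>n. F n - F (Suc n))"
    using F by (intro signed_measures_sums[OF \<mu>]) auto
  then have "(\<lambda>n. \<mu> (F n - F (Suc n))) \<longlonglongrightarrow> 0"
    by (intro summable_LIMSEQ_zero) (rule sums_summable)
  from LIMSEQ_D[OF this, of 1] FS(2) show False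
    by (auto simp: less_le_not_le)
qed

lemma finite_measure_pos_variation:
  "\<mu> \<in> signed_measures M \<Longrightarrow> finite_measure (pos_variation M \<mu>)"
  using signed_measures_finite_variation[of \<mu> M]
  by (intro finite_measureI) auto

lemma finite_measure_neg_variation:
  "\<mu> \<in> signed_measures M \<Longrightarrow> finite_measure (neg_variation M \<mu>)"
  unfolding neg_variation_def
  by (intro finite_measure_pos_variation signed_measures_uminus)

text \<open>No Hahn set is needed: for B inside A, \<open>\<mu> B = \<mu> A - \<mu> (A - B)\<close>
  is at most \<mu> A plus the negative variation of A. The supremum over B gives one inequality, and
  the same argument for -\<mu> the other.\<close>

theorem Jordan_decomposition:
  assumes \<mu>: "\<mu> \<in> signed_measures M" and A: "A \<in> sets M"
  shows "\<mu> A = measure (pos_variation M \<mu>) A - measure (neg_variation M \<mu>) A"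
proof -
  have le: "measure (pos_variation M \<nu>) A \<le> \<nu> A + measure (neg_variation M \<nu>) A"
    if \<nu>: "\<nu> \<in> signed_measures M" for \<nu>
  proof -
    interpret P: finite_measure "pos_variation M \<nu>"
      by (rule finite_measure_pos_variation[OF \<nu>])
    interpret N: finite_measure "neg_variation M \<nu>"
      by (rule finite_measure_neg_variation[OF \<nu>])
    have neg: "- \<nu> C \<le> measure (neg_variation M \<nu>) A" if "C \<in> sets M" "C \<subseteq> A" for C
    proof -
      have "ennreal (- \<nu> C) \<le> emeasure (neg_variation M \<nu>) A"
        unfolding emeasure_neg_variation[OF \<nu> A] using that
        by (rule le_upper_variation[where \<mu> = "\<lambda>A. - \<nu> A"])
      then show ?thesis
        by (simp add: N.emeasure_eq_measure ennreal_le_iff)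
    qed
    have "\<nu> B \<le> \<nu> A + measure (neg_variation M \<nu>) A" if "B \<in> sets M" "B \<subseteq> A" for B
      using neg[of "A - B"] signed_measures_Diff[OF \<nu> A that] that A by auto
    then have "upper_variation M \<nu> A \<le> ennreal (\<nu> A + measure (neg_variation M \<nu>) A)"
      unfolding upper_variation_def by (auto intro!: SUP_least ennreal_leI)
    then have "ennreal (measure (pos_variation M \<nu>) A) \<le>
        ennreal (\<nu> A + measure (neg_variation M \<nu>) A)"
      by (simp add: emeasure_pos_variation[OF \<nu> A, symmetric] P.emeasure_eq_measure)
    then show ?thesis
      using neg[OF A] by (subst (asm) ennreal_le_iff) auto
  qed
  from le[OF \<mu>] le[OF signed_measures_uminus[OF \<mu>]] show ?thesis
    by (simp add: neg_variation_def)
qed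

section \<open>Total variation and bounds for signed integrals\<close>

definition total_variation :: "'a measure \<Rightarrow> ('a set \<Rightarrow> real) \<Rightarrow> real" where
  "total_variation M \<mu> =
    measure (pos_variation M \<mu>) (space M) + measure (neg_variation M \<mu>) (space M)"

lemma total_variation_nonneg: "0 \<le> total_variation M \<mu>"
  by (simp add: total_variation_def)

lemma sum_abs_le_total_variation:
  fixes n :: nat
  assumes \<mu>: "\<mu> \<in> signed_measures M"
    and A: "\<And>i. i < n \<Longrightarrow> A i \<in> sets M" "disjoint_family_on A {..<n}"
  shows "(\<Sum>i<n. \<bar>\<mu> (A i)\<bar>) \<le> total_variation M \<mu>"
proof -
  interpret P: finite_measure "pos_variation M \<mu>"
    by (rule finite_measure_pos_variation[OF \<mu>])
  interpret N: finite_measure "neg_variation M \<mu>"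
    by (rule finite_measure_neg_variation[OF \<mu>])
  have "(\<Sum>i<n. \<bar>\<mu> (A i)\<bar>) \<le>
      (\<Sum>i<n. measure (pos_variation M \<mu>) (A i)) + (\<Sum>i<n. measure (neg_variation M \<mu>) (A i))"
    unfolding sum.distrib[symmetric]
    by (rule sum_mono) (auto simp: Jordan_decomposition[OF \<mu> A(1)] abs_le_iff)
  also have "\<dots> = measure (pos_variation M \<mu>) (\<Union>i<n. A i) + measure (neg_variation M \<mu>) (\<Union>i<n. A i)"
    using A by (intro arg_cong2[where f = "(+)"] P.finite_measure_finite_Union[symmetric]
        N.finite_measure_finite_Union[symmetric]) auto
  also have "\<dots> \<le> total_variation M \<mu>"
    unfolding total_variation_def
    using P.bounded_measure N.bounded_measure by (intro add_mono) auto
  finally show ?thesis .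
qed

lemma integrable_variation_bounded:
  fixes f :: "'a \<Rightarrow> real"
  assumes "\<mu> \<in> signed_measures M" "f \<in> borel_measurable M" "\<And>x. x \<in> space M \<Longrightarrow> \<bar>f x\<bar> \<le> C"
  shows "integrable (pos_variation M \<mu>) f" "integrable (neg_variation M \<mu>) f"
proof -
  interpret P: finite_measure "pos_variation M \<mu>"
    by (rule finite_measure_pos_variation[OF assms(1)])
  interpret N: finite_measure "neg_variation M \<mu>"
    by (rule finite_measure_neg_variation[OF assms(1)])
  show "integrable (pos_variation M \<mu>) f"
    by (rule P.integrable_const_bound[of _ C]) (use assms in auto)
  show "integrable (neg_variation M \<mu>) f"
    by (rule N.integrable_const_bound[of _ C]) (use assms in auto)
qed

lemma abs_signed_integral_le:
  fixes f :: "'a \<Rightarrow> real"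
  assumes "\<mu> \<in> signed_measures M" "f \<in> borel_measurable M" "\<And>x. x \<in> space M \<Longrightarrow> \<bar>f x\<bar> \<le> C"
  shows "\<bar>signed_integral M \<mu> f\<bar> \<le> C * total_variation M \<mu>"
proof -
  have "\<bar>integral\<^sup>L N f\<bar> \<le> C * measure N (space M)"
    if "finite_measure N" "integrable N f" "space N = space M" for N
  proof -
    interpret finite_measure N by fact
    have "\<bar>integral\<^sup>L N f\<bar> \<le> (\<integral>x. \<bar>f x\<bar> \<partial>N)"
      using integral_norm_bound[of N f] by simp
    also have "\<dots> \<le> (\<integral>x. C \<partial>N)"
      using that assms(3) by (intro integral_mono) auto
    finally show ?thesis using that by (simp add: mult.commute)
  qed
  from this[OF finite_measure_pos_variation[OF assms(1)] integrable_variation_bounded(1)[OF assms]]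
    this[OF finite_measure_neg_variation[OF assms(1)] integrable_variation_bounded(2)[OF assms]]
  show ?thesis
    unfolding signed_integral_def total_variation_def by (simp add: algebra_simps)
qed

lemma signed_integral_diff:
  fixes f g :: "'a \<Rightarrow> real"
  assumes "\<mu> \<in> signed_measures M" "f \<in> borel_measurable M" "\<And>x. x \<in> space M \<Longrightarrow> \<bar>f x\<bar> \<le> C"
    and "g \<in> borel_measurable M" "\<And>x. x \<in> space M \<Longrightarrow> \<bar>g x\<bar> \<le> D"
  shows "signed_integral M \<mu> (\<lambda>x. f x - g x) = signed_integral M \<mu> f - signed_integral M \<mu> g"
  using integrable_variation_bounded[OF assms(1-3)] integrable_variation_bounded[OF assms(1,4,5)]
  by (simp add: signed_integral_def)

lemma signed_integral_simple:
  fixes n :: nat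
  assumes \<mu>: "\<mu> \<in> signed_measures M" and A: "\<And>i. i < n \<Longrightarrow> A i \<in> sets M"
  shows "signed_integral M \<mu> (\<lambda>x. \<Sum>i<n. c i * indicator (A i) x) = (\<Sum>i<n. c i * \<mu> (A i))"
proof -
  interpret P: finite_measure "pos_variation M \<mu>"
    by (rule finite_measure_pos_variation[OF \<mu>])
  interpret N: finite_measure "neg_variation M \<mu>"
    by (rule finite_measure_neg_variation[OF \<mu>])
  have "integral\<^sup>L (pos_variation M \<mu>) (\<lambda>x. \<Sum>i<n. c i * indicator (A i) x) =
      (\<Sum>i<n. c i * measure (pos_variation M \<mu>) (A i))"
    using A by (subst Bochner_Integration.integral_sum)
      (auto intro!: sum.cong simp: less_top[symmetric])
  moreover have "integral\<^sup>L (neg_variation M \<mu>) (\<lambda>x. \<Sum>i<n. c i * indicator (A i) x) =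
      (\<Sum>i<n. c i * measure (neg_variation M \<mu>) (A i))"
    using A by (subst Bochner_Integration.integral_sum)
      (auto intro!: sum.cong simp: less_top[symmetric])
  ultimately show ?thesis
    by (simp add: signed_integral_def sum_subtractf[symmetric] right_diff_distrib[symmetric]
        Jordan_decomposition[OF \<mu> A])
qed

lemma signed_integral_const:
  assumes "\<mu> \<in> signed_measures M"
  shows "signed_integral M \<mu> (\<lambda>_. c) = c * \<mu> (space M)"
  unfolding signed_integral_def Jordan_decomposition[OF assms sets.top]
  by (simp add: algebra_simps)

section \<open>Energies as limits of finite sums\<close>

text \<open>The polarisation of \<open>energy\<close>; its symmetry is not visible here and is
  recovered through \<open>discrete_energy\<close>.\<close>

definition mutual_energy ::
  "'a::metric_space set \<Rightarrow> ('a set \<Rightarrow> real) \<Rightarrow> ('a set \<Rightarrow> real) \<Rightarrow> real" where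
  "mutual_energy X \<mu> \<nu> = signed_integral (borel_on X) \<nu> (potential X \<mu>)"

lemma energy_eq_mutual_energy: "energy X \<mu> = mutual_energy X \<mu> \<mu>"
  by (simp add: energy_def mutual_energy_def potential_def[abs_def] dist_commute)

text \<open>Points may repeat and weights may have any sign, so that the configurations in
  \<open>quasihypermetric\<close> are covered directly. The value 0 off the Borel sets is what
  \<open>signed_measures\<close> demands.\<close>

definition point_masses ::
  "'a::metric_space set \<Rightarrow> nat \<Rightarrow> (nat \<Rightarrow> 'a) \<Rightarrow> (nat \<Rightarrow> real) \<Rightarrow> 'a set \<Rightarrow> real" where
  "point_masses X n x \<alpha> A =
    (if A \<in> sets (borel_on X) then \<Sum>i<n. \<alpha> i * indicator A (x i) else 0)"

lemma point_masses_signed: "point_masses X n x \<alpha> \<in> signed_measures (borel_on X)"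
proof -
  have "(\<lambda>k. \<Sum>i<n. \<alpha> i * indicator (A k) (x i)) sums (\<Sum>i<n. \<alpha> i * indicator (\<Union>k. A k) (x i))"
    if "disjoint_family A" for A :: "nat \<Rightarrow> 'a set"
    using that by (intro sums_sum sums_mult indicator_sums) (auto simp: disjoint_family_on_def)
  then show ?thesis
    unfolding signed_measures_def point_masses_def
    by (auto simp: sets.countable_UN range_subsetD)
qed

lemma point_masses_mass:
  assumes "\<And>i. i < n \<Longrightarrow> x i \<in> X"
  shows "point_masses X n x \<alpha> \<in> mass_measures X (\<Sum>i<n. \<alpha> i)"
proof -
  have "X \<in> sets (borel_on X)"
    using sets.top[of "borel_on X"] by (simp add: space_restrict_space)
  then show ?thesis
    using assms point_masses_signed[of X n x \<alpha>]
    by (simp add: mass_measures_def) (simp add: point_masses_def)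
qed

text \<open>Tagged partitions of mesh tending to 0, fixed once for all measures and functions. A tag
  lies in X but not necessarily in its cell, since cells may be empty.\<close>

locale compact_partition =
  fixes X :: "'a::metric_space set" and N :: "nat \<Rightarrow> nat"
    and P :: "nat \<Rightarrow> nat \<Rightarrow> 'a set" and p :: "nat \<Rightarrow> nat \<Rightarrow> 'a"
  assumes compact_X: "compact X"
    and P_sets: "i < N k \<Longrightarrow> P k i \<in> sets (borel_on X)"
    and P_disjoint: "disjoint_family_on (P k) {..<N k}"
    and P_cover: "(\<Union>i<N k. P k i) = X"
    and p_in: "i < N k \<Longrightarrow> p k i \<in> X"
    and p_close: "i < N k \<Longrightarrow> y \<in> P k i \<Longrightarrow> dist y (p k i) \<le> inverse (real (Suc k))"
begin

abbreviation "\<M> \<equiv> signed_measures (borel_on X)"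
abbreviation "tv \<equiv> total_variation (borel_on X)"

definition step :: "nat \<Rightarrow> ('a \<Rightarrow> real) \<Rightarrow> 'a \<Rightarrow> real" where
  "step k f x = (\<Sum>i<N k. f (p k i) * indicator (P k i) x)"

definition riemann_sum :: "nat \<Rightarrow> ('a set \<Rightarrow> real) \<Rightarrow> ('a \<Rightarrow> real) \<Rightarrow> real" where
  "riemann_sum k \<mu> f = (\<Sum>i<N k. f (p k i) * \<mu> (P k i))"

definition discrete_energy :: "nat \<Rightarrow> ('a set \<Rightarrow> real) \<Rightarrow> ('a set \<Rightarrow> real) \<Rightarrow> real" where
  "discrete_energy k \<mu> \<nu> =
    (\<Sum>i<N k. \<Sum>j<N k. \<mu> (P k i) * \<nu> (P k j) * dist (p k i) (p k j))"

lemma space_borel_on: "space (borel_on X) = X"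
  by (simp add: space_restrict_space)

lemma step_eq:
  assumes "i < N k" "x \<in> P k i"
  shows "step k f x = f (p k i)"
proof -
  have "indicator (P k j) x = (if j = i then 1 else 0 :: real)" if "j < N k" for j
    using disjoint_family_onD[OF P_disjoint, of i k j] assms that by (auto simp: indicator_def)
  then have "step k f x = (\<Sum>j<N k. if j = i then f (p k j) else 0)"
    unfolding step_def by (intro sum.cong) auto
  also have "\<dots> = f (p k i)"
    using assms by simp
  finally show ?thesis .
qed

lemma step_error:
  assumes "\<And>x y. x \<in> X \<Longrightarrow> y \<in> X \<Longrightarrow> dist x y \<le> inverse (real (Suc k)) \<Longrightarrow> \<bar>f x - f y\<bar> \<le> e"
    and "x \<in> X"
  shows "\<bar>f x - step k f x\<bar> \<le> e"
proof -
  obtain i where "i < N k" "x \<in> P k i"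
    using assms(2) P_cover[of k] by blast
  then show ?thesis
    using assms p_in p_close by (simp add: step_eq)
qed

lemma continuous_on_bounded_measurable:
  assumes "continuous_on X (f :: 'a \<Rightarrow> real)"
  obtains C where "f \<in> borel_measurable (borel_on X)" "\<And>x. x \<in> space (borel_on X) \<Longrightarrow> \<bar>f x\<bar> \<le> C"
proof -
  obtain C where "\<And>x. x \<in> X \<Longrightarrow> \<bar>f x\<bar> \<le> C"
    using compact_imp_bounded[OF compact_continuous_image[OF assms compact_X]]
    unfolding bounded_iff by auto
  then show ?thesis
    using that borel_measurable_continuous_on_restrict[OF assms] by (auto simp: space_borel_on)
qed

text \<open>The Riemann sum is the integral of \<open>step k f\<close>, which is uniformly e-close
  to f. The explicit error allows a bound that is uniform over a family of integrands, as
  \<open>discrete_energy_tendsto\<close> requires.\<close>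

lemma integral_riemann_error:
  assumes \<mu>: "\<mu> \<in> \<M>" and f: "continuous_on X f"
    and e: "\<And>x y. x \<in> X \<Longrightarrow> y \<in> X \<Longrightarrow> dist x y \<le> inverse (real (Suc k)) \<Longrightarrow> \<bar>f x - f y\<bar> \<le> e"
  shows "\<bar>signed_integral (borel_on X) \<mu> f - riemann_sum k \<mu> f\<bar> \<le> e * tv \<mu>"
proof -
  obtain C where C: "f \<in> borel_measurable (borel_on X)"
    "\<And>x. x \<in> space (borel_on X) \<Longrightarrow> \<bar>f x\<bar> \<le> C"
    using continuous_on_bounded_measurable[OF f] by blast
  have m: "step k f \<in> borel_measurable (borel_on X)"
    unfolding step_def[abs_def] using P_sets by (intro borel_measurable_sum borel_measurable_times borel_measurable_const borel_measurable_indicator) auto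
  have err: "\<bar>f x - step k f x\<bar> \<le> e" if "x \<in> space (borel_on X)" for x
    using step_error[OF e] that by (simp add: space_borel_on)
  have b: "\<bar>step k f x\<bar> \<le> C + e" if "x \<in> space (borel_on X)" for x
    using err[OF that] C(2)[OF that] by linarith
  have "riemann_sum k \<mu> f = signed_integral (borel_on X) \<mu> (step k f)"
    unfolding step_def[abs_def] riemann_sum_def
    using P_sets by (subst signed_integral_simple[OF \<mu>]) auto
  then have "signed_integral (borel_on X) \<mu> f - riemann_sum k \<mu> f =
      signed_integral (borel_on X) \<mu> (\<lambda>x. f x - step k f x)"
    using signed_integral_diff[OF \<mu> C m b] by simp
  also have "\<bar>\<dots>\<bar> \<le> e * tv \<mu>"
    using C(1) m err by (intro abs_signed_integral_le[OF \<mu>]) auto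
  finally show ?thesis .
qed

lemma eventually_small_oscillation:
  assumes "continuous_on X (f :: 'a \<Rightarrow> real)" "e > 0"
  shows "\<forall>\<^sub>F k in sequentially. \<forall>x\<in>X. \<forall>y\<in>X.
    dist x y \<le> inverse (real (Suc k)) \<longrightarrow> \<bar>f x - f y\<bar> \<le> e"
proof -
  obtain d where d: "d > 0" "\<And>x y. x \<in> X \<Longrightarrow> y \<in> X \<Longrightarrow> dist y x < d \<Longrightarrow> dist (f y) (f x) < e"
    using compact_uniformly_continuous[OF assms(1) compact_X] assms(2)
    unfolding uniformly_continuous_on_def by metis
  have "\<forall>\<^sub>F k in sequentially. inverse (real (Suc k)) < d"
    using order_tendstoD(2)[OF LIMSEQ_inverse_real_of_nat d(1)] .
  then show ?thesis
  proof eventually_elim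
    case (elim k)
    then show ?case
      using d(2) by (fastforce simp: dist_real_def dist_commute)
  qed
qed

lemma riemann_sum_tendsto:
  assumes \<mu>: "\<mu> \<in> \<M>" and f: "continuous_on X f"
  shows "(\<lambda>k. riemann_sum k \<mu> f) \<longlonglongrightarrow> signed_integral (borel_on X) \<mu> f"
proof (rule tendstoI)
  fix e :: real assume "e > 0"
  define e' where "e' = e / (tv \<mu> + 1)"
  have tv: "tv \<mu> + 1 > 0"
    using total_variation_nonneg[of "borel_on X" \<mu>] by simp
  then have e': "e' > 0" "e' * tv \<mu> < e"
    using \<open>e > 0\<close> by (auto simp: e'_def field_simps)
  from eventually_small_oscillation[OF f e'(1)]
  show "\<forall>\<^sub>F k in sequentially. dist (riemann_sum k \<mu> f) (signed_integral (borel_on X) \<mu> f) < e"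
  proof eventually_elim
    case (elim k)
    then have "\<bar>signed_integral (borel_on X) \<mu> f - riemann_sum k \<mu> f\<bar> \<le> e' * tv \<mu>"
      by (intro integral_riemann_error[OF \<mu> f]) auto
    then show ?case
      using e'(2) by (simp add: dist_real_def)
  qed
qed

lemma step_tendsto:
  assumes "continuous_on X f" "x \<in> X"
  shows "(\<lambda>k. step k f x) \<longlonglongrightarrow> f x"
proof (rule tendstoI)
  fix e :: real assume "e > 0"
  then have "\<forall>\<^sub>F k in sequentially. \<forall>x\<in>X. \<forall>y\<in>X.
      dist x y \<le> inverse (real (Suc k)) \<longrightarrow> \<bar>f x - f y\<bar> \<le> e / 2"
    by (intro eventually_small_oscillation[OF assms(1)]) auto
  then show "\<forall>\<^sub>F k in sequentially. dist (step k f x) (f x) < e"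
  proof eventually_elim
    case (elim k)
    then have "\<bar>f x - step k f x\<bar> \<le> e / 2"
      by (intro step_error assms(2)) auto
    then show ?case
      using \<open>e > 0\<close> by (simp add: dist_real_def abs_minus_commute)
  qed
qed

text \<open>Because of repetitions and cancellation, the variations of \<open>point_masses\<close>
  are not computed. Its Riemann sums are weighted sums of \<open>step k f (x i)\<close>, and both
  sides are identified as their limit.\<close>

lemma signed_integral_point_masses:
  assumes f: "continuous_on X f" and x: "\<And>i. i < n \<Longrightarrow> x i \<in> X"
  shows "signed_integral (borel_on X) (point_masses X n x \<alpha>) f = (\<Sum>i<n. \<alpha> i * f (x i))"
proof -
  have "riemann_sum k (point_masses X n x \<alpha>) f = (\<Sum>i<n. \<alpha> i * step k f (x i))" for k
  proof -
    have "riemann_sum k (point_masses X n x \<alpha>) f =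
        (\<Sum>j<N k. \<Sum>i<n. \<alpha> i * (f (p k j) * indicator (P k j) (x i)))"
      unfolding riemann_sum_def point_masses_def
      by (intro sum.cong refl)
        (simp add: P_sets sum_distrib_left mult.left_commute del: sum_mult_indicator)
    also have "\<dots> = (\<Sum>i<n. \<alpha> i * step k f (x i))"
      unfolding step_def sum_distrib_left by (rule sum.swap)
    finally show ?thesis .
  qed
  moreover have "(\<lambda>k. \<Sum>i<n. \<alpha> i * step k f (x i)) \<longlonglongrightarrow> (\<Sum>i<n. \<alpha> i * f (x i))"
    using x by (intro tendsto_sum tendsto_mult_left step_tendsto[OF f]) auto
  ultimately show ?thesis
    using riemann_sum_tendsto[OF point_masses_signed f, of n x \<alpha>] LIMSEQ_unique by auto
qed

lemma potential_point_masses: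
  assumes "\<And>i. i < n \<Longrightarrow> x i \<in> X"
  shows "potential X (point_masses X n x \<alpha>) z = (\<Sum>i<n. \<alpha> i * dist z (x i))"
  unfolding potential_def using assms
  by (intro signed_integral_point_masses continuous_intros)

lemma potential_lipschitz:
  assumes \<mu>: "\<mu> \<in> \<M>"
  shows "\<bar>potential X \<mu> x - potential X \<mu> y\<bar> \<le> dist x y * tv \<mu>"
proof -
  have cont: "continuous_on X (dist z)" for z
    by (intro continuous_intros)
  obtain C where C: "dist x \<in> borel_measurable (borel_on X)"
    "\<And>z. z \<in> space (borel_on X) \<Longrightarrow> \<bar>dist x z\<bar> \<le> C"
    using continuous_on_bounded_measurable[OF cont] by blast
  obtain D where D: "dist y \<in> borel_measurable (borel_on X)"
    "\<And>z. z \<in> space (borel_on X) \<Longrightarrow> \<bar>dist y z\<bar> \<le> D"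
    using continuous_on_bounded_measurable[OF cont] by blast
  have "potential X \<mu> x - potential X \<mu> y =
      signed_integral (borel_on X) \<mu> (\<lambda>z. dist x z - dist y z)"
    unfolding potential_def using signed_integral_diff[OF \<mu> C D] by simp
  also have "\<bar>\<dots>\<bar> \<le> dist x y * tv \<mu>"
    using abs_dist_diff_le[of x _ y]
    by (intro abs_signed_integral_le[OF \<mu>] borel_measurable_diff C(1) D(1))
      (simp add: dist_commute[of y])
  finally show ?thesis .
qed

lemma continuous_on_potential:
  assumes "\<mu> \<in> \<M>"
  shows "continuous_on X (potential X \<mu>)"
proof (rule lipschitz_on_continuous_on)
  show "(tv \<mu>)-lipschitz_on X (potential X \<mu>)"
    using potential_lipschitz[OF assms]
    by (intro lipschitz_onI) (auto simp: dist_real_def total_variation_nonneg mult.commute)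
qed

lemma mutual_energy_point_masses:
  assumes "\<mu> \<in> \<M>" "\<And>i. i < n \<Longrightarrow> x i \<in> X"
  shows "mutual_energy X \<mu> (point_masses X n x \<alpha>) = (\<Sum>i<n. \<alpha> i * potential X \<mu> (x i))"
  unfolding mutual_energy_def using assms
  by (intro signed_integral_point_masses continuous_on_potential)

lemma energy_point_masses:
  assumes "\<And>i. i < n \<Longrightarrow> x i \<in> X"
  shows "energy X (point_masses X n x \<alpha>) = (\<Sum>i<n. \<Sum>j<n. \<alpha> i * \<alpha> j * dist (x i) (x j))"
  using assms
  by (simp add: energy_eq_mutual_energy mutual_energy_point_masses point_masses_signed
      potential_point_masses sum_distrib_left mult.assoc)

text \<open>Two replacements, each costing
  \<open>inverse (real (Suc k)) * tv \<mu> * tv \<nu>\<close>: the outer integral by a Riemann sum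
  of the potential, then the potential at every tag by its own Riemann sum. Hence the factor
  2.\<close>

lemma discrete_energy_tendsto:
  assumes \<mu>: "\<mu> \<in> \<M>" and \<nu>: "\<nu> \<in> \<M>"
  shows "(\<lambda>k. discrete_energy k \<mu> \<nu>) \<longlonglongrightarrow> mutual_energy X \<mu> \<nu>"
proof -
  have bound: "\<bar>mutual_energy X \<mu> \<nu> - discrete_energy k \<mu> \<nu>\<bar> \<le> inverse (real (Suc k)) * (2 * tv \<mu> * tv \<nu>)" for k
  proof -
    let ?e = "inverse (real (Suc k))"
    have 1: "\<bar>potential X \<mu> x - potential X \<mu> y\<bar> \<le> ?e * tv \<mu>" if "dist x y \<le> ?e" for x y :: 'a
      using potential_lipschitz[OF \<mu>, of x y] mult_right_mono[OF that total_variation_nonneg]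
      by (rule order_trans)
    have 2: "\<bar>mutual_energy X \<mu> \<nu> - riemann_sum k \<nu> (potential X \<mu>)\<bar> \<le> ?e * tv \<mu> * tv \<nu>"
      unfolding mutual_energy_def
      by (rule integral_riemann_error[OF \<nu> continuous_on_potential[OF \<mu>]]) (rule 1)
    have 3: "\<bar>potential X \<mu> x - riemann_sum k \<mu> (dist x)\<bar> \<le> ?e * tv \<mu>" for x
      unfolding potential_def
    proof (rule integral_riemann_error[OF \<mu>])
      show "continuous_on X (dist x)" by (intro continuous_intros)
      fix y z :: 'a assume "dist y z \<le> ?e"
      then show "\<bar>dist x y - dist x z\<bar> \<le> ?e"
        using abs_dist_diff_le[of y x z] by (simp add: dist_commute)
    qed
    have eq: "discrete_energy k \<mu> \<nu> = riemann_sum k \<nu> (\<lambda>x. riemann_sum k \<mu> (dist x))"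
      unfolding discrete_energy_def riemann_sum_def sum_distrib_right
      by (subst sum.swap) (auto intro!: sum.cong simp: dist_commute)
    have "\<bar>riemann_sum k \<nu> (potential X \<mu>) - discrete_energy k \<mu> \<nu>\<bar> =
        \<bar>\<Sum>i<N k. (potential X \<mu> (p k i) - riemann_sum k \<mu> (dist (p k i))) * \<nu> (P k i)\<bar>"
      unfolding eq unfolding riemann_sum_def[of k \<nu>]
      by (simp add: sum_subtractf left_diff_distrib)
    also have "\<dots> \<le> (\<Sum>i<N k. (?e * tv \<mu>) * \<bar>\<nu> (P k i)\<bar>)"
      by (intro order_trans[OF sum_abs] sum_mono) (simp only: abs_mult mult_right_mono[OF 3 abs_ge_zero])
    also have "\<dots> = (?e * tv \<mu>) * (\<Sum>i<N k. \<bar>\<nu> (P k i)\<bar>)"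
      by (rule sum_distrib_left[symmetric])
    also have "\<dots> \<le> (?e * tv \<mu>) * tv \<nu>"
      using P_sets P_disjoint
      by (intro mult_left_mono sum_abs_le_total_variation[OF \<nu>] mult_nonneg_nonneg)
         (auto simp: total_variation_nonneg)
    finally show ?thesis
      using 2 by (simp add: algebra_simps)
  qed
  have "(\<lambda>k. inverse (real (Suc k)) * (2 * tv \<mu> * tv \<nu>)) \<longlonglongrightarrow> 0"
    by (rule tendsto_mult_left_zero[OF LIMSEQ_inverse_real_of_nat])
  then have "(\<lambda>k. mutual_energy X \<mu> \<nu> - discrete_energy k \<mu> \<nu>) \<longlonglongrightarrow> 0"
    by (rule Lim_null_comparison[rotated]) (use bound in \<open>simp del: of_nat_Suc\<close>)
  then have "(\<lambda>k. mutual_energy X \<mu> \<nu> - (mutual_energy X \<mu> \<nu> - discrete_energy k \<mu> \<nu>))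
      \<longlonglongrightarrow> mutual_energy X \<mu> \<nu> - 0"
    by (intro tendsto_intros)
  then show ?thesis by simp
qed

text \<open>\<open>discrete_energy k\<close> is bilinear in the cell values and symmetric because
  \<open>dist\<close> is; the limit inherits both, which avoids an exchange of integrals.\<close>

lemma energy_lin_comb:
  assumes "\<mu> \<in> \<M>" "\<nu> \<in> \<M>"
  shows "energy X (\<lambda>A. a * \<mu> A + b * \<nu> A) =
    a\<^sup>2 * energy X \<mu> + 2 * a * b * mutual_energy X \<mu> \<nu> + b\<^sup>2 * energy X \<nu>"
proof -
  have sym: "discrete_energy k \<nu> \<mu> = discrete_energy k \<mu> \<nu>" for k
    unfolding discrete_energy_def
    by (subst sum.swap) (auto intro!: sum.cong simp: dist_commute)
  have "discrete_energy k (\<lambda>A. a * \<mu> A + b * \<nu> A) (\<lambda>A. a * \<mu> A + b * \<nu> A) =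
      a\<^sup>2 * discrete_energy k \<mu> \<mu> + a * b * discrete_energy k \<mu> \<nu> +
      a * b * discrete_energy k \<nu> \<mu> + b\<^sup>2 * discrete_energy k \<nu> \<nu>" for k
    unfolding discrete_energy_def sum_distrib_left sum.distrib[symmetric]
    by (intro sum.cong refl) (simp add: algebra_simps power2_eq_square)
  then have eq: "discrete_energy k (\<lambda>A. a * \<mu> A + b * \<nu> A) (\<lambda>A. a * \<mu> A + b * \<nu> A) =
      a\<^sup>2 * discrete_energy k \<mu> \<mu> + 2 * a * b * discrete_energy k \<mu> \<nu> +
      b\<^sup>2 * discrete_energy k \<nu> \<nu>" for k
    by (simp add: sym)
  show ?thesis
    unfolding energy_eq_mutual_energy
  proof (rule LIMSEQ_unique)
    show "(\<lambda>k. discrete_energy k (\<lambda>A. a * \<mu> A + b * \<nu> A) (\<lambda>A. a * \<mu> A + b * \<nu> A)) \<longlonglongrightarrow>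
        mutual_energy X (\<lambda>A. a * \<mu> A + b * \<nu> A) (\<lambda>A. a * \<mu> A + b * \<nu> A)"
      using signed_measures_lin_comb[OF assms, of a b] by (intro discrete_energy_tendsto)
    show "(\<lambda>k. discrete_energy k (\<lambda>A. a * \<mu> A + b * \<nu> A) (\<lambda>A. a * \<mu> A + b * \<nu> A)) \<longlonglongrightarrow>
        a\<^sup>2 * mutual_energy X \<mu> \<mu> + 2 * a * b * mutual_energy X \<mu> \<nu> + b\<^sup>2 * mutual_energy X \<nu> \<nu>"
      unfolding eq by (intro tendsto_intros discrete_energy_tendsto assms)
  qed
qed

lemma energy_diff:
  assumes "\<mu> \<in> \<M>" "\<nu> \<in> \<M>"
  shows "energy X (\<lambda>A. \<mu> A - \<nu> A) = energy X \<mu> - 2 * mutual_energy X \<mu> \<nu> + energy X \<nu>"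
  using energy_lin_comb[OF assms, of 1 "-1"] by simp

lemma sum_cells:
  assumes "\<mu> \<in> mass_measures X t"
  shows "(\<Sum>i<N k. \<mu> (P k i)) = t"
  using assms signed_measures_finite_UN[of \<mu> "borel_on X" "N k" "P k"] P_sets P_disjoint P_cover
  by (simp add: mass_measures_def)

text \<open>The cell values of \<mu> are weights of the same total mass placed at the tags, so each
  discrete energy is an admissible finite sum. Used with mass 0 for negativity and with mass 1 for
  the sphere bound.\<close>

lemma energy_le_if_finite_sums_le:
  assumes "\<And>(n::nat) x \<alpha>. (\<And>i. i < n \<Longrightarrow> x i \<in> X) \<Longrightarrow> (\<Sum>i<n. \<alpha> i) = t \<Longrightarrow>
      (\<Sum>i<n. \<Sum>j<n. \<alpha> i * \<alpha> j * dist (x i) (x j)) \<le> C"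
    and "\<mu> \<in> mass_measures X t"
  shows "energy X \<mu> \<le> C"
proof (rule LIMSEQ_le_const2)
  show "(\<lambda>k. discrete_energy k \<mu> \<mu>) \<longlonglongrightarrow> energy X \<mu>"
    unfolding energy_eq_mutual_energy using assms(2)
    by (intro discrete_energy_tendsto) (auto simp: mass_measures_def)
  show "\<exists>K. \<forall>k\<ge>K. discrete_energy k \<mu> \<mu> \<le> C"
    unfolding discrete_energy_def
    by (rule exI[of _ 0], intro allI impI assms(1) p_in sum_cells[OF assms(2)])
qed

lemma energy_mass_zero_nonpos:
  assumes "quasihypermetric X" "\<mu> \<in> mass_measures X 0"
  shows "energy X \<mu> \<le> 0"
  using assms(1) unfolding quasihypermetric_def
  by (intro energy_le_if_finite_sums_le[OF _ assms(2)]) blast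

end

lemma ex_compact_partition:
  fixes X :: "'a::metric_space set"
  assumes "compact X"
  shows "\<exists>N P p. compact_partition X N P p"
proof -
  have "\<exists>(n::nat) A q. (\<forall>i<n. A i \<in> sets (borel_on X)) \<and> disjoint_family_on A {..<n} \<and>
      (\<Union>i<n. A i) = X \<and> (\<forall>i<n. q i \<in> X \<and> (\<forall>y\<in>A i. dist y (q i) \<le> e))"
    if "e > 0" for e :: real
  proof -
    have cover: "X \<subseteq> (\<Union>x\<in>X. ball x e)"
      using that by auto
    obtain F where F: "finite F" "F \<subseteq> X" "X \<subseteq> (\<Union>x\<in>F. ball x e)"
      by (rule compactE_image[OF assms open_ball cover]) (rule that)
    obtain q :: "nat \<Rightarrow> 'a" and n where q: "F = q ` {..<n}"
      using finite_imp_nat_seg_image_inj_on[OF F(1)] by (auto simp: lessThan_def)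
    \<comment> \<open>Removing the earlier balls makes the cells disjoint; a cell may thereby lose
      its own tag or become empty.\<close>
    define A where "A i = X \<inter> ball (q i) e - (\<Union>j<i. ball (q j) e)" for i
    have "A i \<in> sets (borel_on X)" for i
    proof -
      have "A i = X \<inter> (ball (q i) e - (\<Union>j<i. ball (q j) e))"
        unfolding A_def by blast
      then show ?thesis
        unfolding sets_restrict_space by (rule image_eqI) auto
    qed
    moreover have "disjoint_family_on A {..<n}"
      unfolding disjoint_family_on_def
    proof (intro ballI impI)
      fix i j :: nat assume "i \<noteq> j"
      then consider "i < j" | "j < i" by linarith
      then show "A i \<inter> A j = {}"
        by cases (auto simp: A_def)
    qed
    moreover have "(\<Union>i<n. A i) = X"
    proof
      show "X \<subseteq> (\<Union>i<n. A i)"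
      proof
        fix x assume x: "x \<in> X"
        then have ex: "\<exists>i. i < n \<and> x \<in> ball (q i) e"
          using F(3) unfolding q by blast
        define i where "i = (LEAST i. i < n \<and> x \<in> ball (q i) e)"
        have "i < n \<and> x \<in> ball (q i) e"
          unfolding i_def by (rule LeastI_ex[OF ex])
        moreover have "x \<notin> ball (q j) e" if "j < i" for j
          using not_less_Least[of j "\<lambda>i. i < n \<and> x \<in> ball (q i) e"] that calculation
          unfolding i_def by linarith
        ultimately show "x \<in> (\<Union>i<n. A i)"
          using x by (auto simp: A_def)
      qed
    qed (auto simp: A_def)
    moreover have "\<forall>i<n. q i \<in> X \<and> (\<forall>y\<in>A i. dist y (q i) \<le> e)"
      using F(2) unfolding q by (auto simp: A_def dist_commute)
    ultimately show ?thesis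
      by blast
  qed
  then have "\<forall>k. \<exists>(n::nat) A q. (\<forall>i<n. A i \<in> sets (borel_on X)) \<and> disjoint_family_on A {..<n} \<and>
      (\<Union>i<n. A i) = X \<and> (\<forall>i<n. q i \<in> X \<and> (\<forall>y\<in>A i. dist y (q i) \<le> inverse (real (Suc k))))"
    by (simp del: of_nat_Suc)
  then obtain N :: "nat \<Rightarrow> nat" and P p where "\<forall>k. (\<forall>i<N k. P k i \<in> sets (borel_on X)) \<and>
      disjoint_family_on (P k) {..<N k} \<and> (\<Union>i<N k. P k i) = X \<and>
      (\<forall>i<N k. p k i \<in> X \<and> (\<forall>y\<in>P k i. dist y (p k i) \<le> inverse (real (Suc k))))"
    by metis
  then have "compact_partition X N P p"
    using assms by unfold_locales auto
  then show ?thesis by blast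
qed

section \<open>Existence of S-embeddings\<close>

definition psd_kernel :: "'a set \<Rightarrow> ('a \<Rightarrow> 'a \<Rightarrow> real) \<Rightarrow> bool" where
  "psd_kernel X K \<longleftrightarrow> (\<forall>x\<in>X. \<forall>y\<in>X. K x y = K y x) \<and>
    (\<forall>(n::nat) x \<alpha>. (\<forall>i<n. x i \<in> X) \<longrightarrow> 0 \<le> (\<Sum>i<n. \<Sum>j<n. \<alpha> i * \<alpha> j * K (x i) (x j)))"

text \<open>K is not assumed semidefinite, because the expansion is applied both to such kernels and
  to \<open>dist\<close> itself.\<close>

lemma quadratic_form_add_point:
  fixes K :: "'a \<Rightarrow> 'a \<Rightarrow> real"
  assumes "\<And>i. i < n \<Longrightarrow> K q (x i) = K (x i) q"
  shows "(\<Sum>i<Suc n. \<Sum>j<Suc n. (\<alpha>(n := b)) i * (\<alpha>(n := b)) j * K ((x(n := q)) i) ((x(n := q)) j)) =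
    (\<Sum>i<n. \<Sum>j<n. \<alpha> i * \<alpha> j * K (x i) (x j)) + 2 * b * (\<Sum>i<n. \<alpha> i * K (x i) q) + b\<^sup>2 * K q q"
proof -
  have "(\<Sum>j<n. b * \<alpha> j * K q (x j)) = (\<Sum>i<n. \<alpha> i * b * K (x i) q)"
    using assms by (intro sum.cong) auto
  moreover have "(\<Sum>i<n. \<alpha> i * b * K (x i) q) = b * (\<Sum>i<n. \<alpha> i * K (x i) q)"
    by (simp add: sum_distrib_left mult_ac)
  ultimately show ?thesis
    by (simp add: sum.distrib power2_eq_square)
qed

lemma psd_kernel_sym: "psd_kernel X K \<Longrightarrow> x \<in> X \<Longrightarrow> y \<in> X \<Longrightarrow> K x y = K y x"
  by (simp add: psd_kernel_def)

lemma psd_kernel_nonneg: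
  "psd_kernel X K \<Longrightarrow> (\<And>i. i < n \<Longrightarrow> x i \<in> X) \<Longrightarrow>
    0 \<le> (\<Sum>i<n. \<Sum>j<n. \<alpha> i * \<alpha> j * K (x i) (x j))" for n :: nat
  by (simp add: psd_kernel_def)

lemma psd_kernel_add_point_nonneg:
  fixes n :: nat
  assumes K: "psd_kernel X K" and x: "\<And>i. i < n \<Longrightarrow> x i \<in> X" and q: "q \<in> X"
  shows "0 \<le> (\<Sum>i<n. \<Sum>j<n. \<alpha> i * \<alpha> j * K (x i) (x j)) + 2 * b * (\<Sum>i<n. \<alpha> i * K (x i) q) + b\<^sup>2 * K q q"
proof -
  have "0 \<le> (\<Sum>i<Suc n. \<Sum>j<Suc n. (\<alpha>(n := b)) i * (\<alpha>(n := b)) j * K ((x(n := q)) i) ((x(n := q)) j))"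
    using x q by (intro psd_kernel_nonneg[OF K]) (auto simp: less_Suc_eq)
  then show ?thesis
    using x q psd_kernel_sym[OF K] by (subst (asm) quadratic_form_add_point) auto
qed

lemma psd_kernel_two_points:
  assumes "psd_kernel X K" "x \<in> X" "y \<in> X"
  shows "0 \<le> a\<^sup>2 * K x x + 2 * a * b * K x y + b\<^sup>2 * K y y"
  using psd_kernel_add_point_nonneg[OF assms(1), of 1 "\<lambda>_. x" y "\<lambda>_. a" b] assms
  by (simp add: power2_eq_square algebra_simps)

lemma psd_kernel_diag_nonneg: "psd_kernel X K \<Longrightarrow> x \<in> X \<Longrightarrow> 0 \<le> K x x"
  using psd_kernel_two_points[of X K x x 1 0] by simp

text \<open>With \<open>K y y = 0\<close> the two-point form is affine in b, so nonnegativity forces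
  its slope to vanish. The chosen b gives it the value -1.\<close>

lemma psd_kernel_diag_zero:
  assumes "psd_kernel X K" "x \<in> X" "y \<in> X" "K y y = 0"
  shows "K x y = 0"
proof (rule ccontr)
  assume "K x y \<noteq> 0"
  with psd_kernel_two_points[OF assms(1-3), of 1 "- (K x x + 1) / (2 * K x y)"] assms(4)
  show False by (simp add: field_simps)
qed

text \<open>If \<open>K q q = 0\<close>, division by zero returns 0 and K stays unchanged; in the
  semidefinite case the column of q is then already zero.\<close>

definition schur_complement :: "('a \<Rightarrow> 'a \<Rightarrow> real) \<Rightarrow> 'a \<Rightarrow> 'a \<Rightarrow> 'a \<Rightarrow> real" where
  "schur_complement K q x y = K x y - K x q * K y q / K q q"

lemma psd_kernel_schur_complement:
  assumes K: "psd_kernel X K" and q: "q \<in> X"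
  shows "psd_kernel X (schur_complement K q)"
  unfolding psd_kernel_def
proof (intro conjI ballI allI impI)
  fix x y assume "x \<in> X" "y \<in> X"
  then show "schur_complement K q x y = schur_complement K q y x"
    using psd_kernel_sym[OF K] by (simp add: schur_complement_def)
next
  fix n :: nat and x \<alpha> assume x: "\<forall>i<n. x i \<in> X"
  define L where "L = (\<Sum>i<n. \<alpha> i * K (x i) q)"
  have "L * L = (\<Sum>i<n. \<Sum>j<n. \<alpha> i * K (x i) q * (\<alpha> j * K (x j) q))"
    unfolding L_def by (rule sum_product)
  then have "(\<Sum>i<n. \<Sum>j<n. \<alpha> i * \<alpha> j * schur_complement K q (x i) (x j)) =
      (\<Sum>i<n. \<Sum>j<n. \<alpha> i * \<alpha> j * K (x i) (x j)) - L * L / K q q"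
    by (simp add: schur_complement_def right_diff_distrib sum_subtractf sum_divide_distrib mult_ac)
  \<comment> \<open>The weight \<open>- L / K q q\<close> at q minimises the enlarged form when
    \<open>K q q\<close> is positive; the minimum is the form of the Schur complement. For
    \<open>K q q = 0\<close> the weight is 0.\<close>
  moreover have "0 \<le> (\<Sum>i<n. \<Sum>j<n. \<alpha> i * \<alpha> j * K (x i) (x j)) + 2 * (- L / K q q) * L + (- L / K q q)\<^sup>2 * K q q"
    unfolding L_def using x q by (intro psd_kernel_add_point_nonneg[OF K]) auto
  moreover have "2 * (- L / K q q) * L + (- L / K q q)\<^sup>2 * K q q = - (L * L / K q q)"
    by (cases "K q q = 0") (auto simp: field_simps power2_eq_square)
  ultimately show "0 \<le> (\<Sum>i<n. \<Sum>j<n. \<alpha> i * \<alpha> j * schur_complement K q (x i) (x j))"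
    by linarith
qed

section \<open>Cholesky elimination along a sequence\<close>

fun eliminate :: "('a \<Rightarrow> 'a \<Rightarrow> real) \<Rightarrow> (nat \<Rightarrow> 'a) \<Rightarrow> nat \<Rightarrow> 'a \<Rightarrow> 'a \<Rightarrow> real" where
  "eliminate K s 0 = K"
| "eliminate K s (Suc n) = schur_complement (eliminate K s n) (s n)"

text \<open>A zero pivot gives the coordinate 0, so a point met again after its elimination does no
  harm.\<close>

definition cholesky_coord :: "('a \<Rightarrow> 'a \<Rightarrow> real) \<Rightarrow> (nat \<Rightarrow> 'a) \<Rightarrow> nat \<Rightarrow> 'a \<Rightarrow> real" where
  "cholesky_coord K s n x = eliminate K s n x (s n) / sqrt (eliminate K s n (s n) (s n))"

lemma psd_kernel_eliminate:
  "psd_kernel X K \<Longrightarrow> range s \<subseteq> X \<Longrightarrow> psd_kernel X (eliminate K s n)"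
  by (induction n) (auto intro: psd_kernel_schur_complement)

lemma eliminate_decomposition:
  assumes K: "psd_kernel X K" and s: "range s \<subseteq> X"
  shows "K x y = (\<Sum>m<n. cholesky_coord K s m x * cholesky_coord K s m y) + eliminate K s n x y"
proof (induction n)
  case (Suc n)
  have "0 \<le> eliminate K s n (s n) (s n)"
    using s by (intro psd_kernel_diag_nonneg[OF psd_kernel_eliminate[OF K s]]) auto
  then have "eliminate K s n x y =
      cholesky_coord K s n x * cholesky_coord K s n y + eliminate K s (Suc n) x y"
    by (simp add: cholesky_coord_def schur_complement_def real_sqrt_mult_self)
  then show ?case
    using Suc by simp
qed simp

text \<open>Eliminating \<open>s n\<close> clears its column; a zero pivot means the column was
  already zero. Later corrections to column \<open>s m\<close> carry the factor
  \<open>eliminate K s n (s m) (s n)\<close>, which vanishes by symmetry and induction.\<close>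

lemma eliminate_vanishes:
  assumes K: "psd_kernel X K" and s: "range s \<subseteq> X" and "m < n" "x \<in> X"
  shows "eliminate K s n x (s m) = 0"
  using \<open>m < n\<close> \<open>x \<in> X\<close>
proof (induction n arbitrary: x)
  case (Suc n)
  note psd = psd_kernel_eliminate[OF K s, of n]
  show ?case
  proof (cases "m = n")
    case True
    then show ?thesis
      using psd_kernel_diag_zero[OF psd \<open>x \<in> X\<close>, of "s n"] s
      by (cases "eliminate K s n (s n) (s n) = 0") (auto simp: schur_complement_def)
  next
    case False
    then have "m < n" using Suc.prems by simp
    then have "eliminate K s n x (s m) = 0" "eliminate K s n (s n) (s m) = 0"
      using Suc.IH Suc.prems(2) s by auto
    then show ?thesis
      using psd_kernel_sym[OF psd, of "s m" "s n"] s by (auto simp: schur_complement_def)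
  qed
qed simp

text \<open>The squared distance between the feature vectors of x and y when K is regarded as their
  Gram kernel.\<close>

definition kernel_dist :: "('a \<Rightarrow> 'a \<Rightarrow> real) \<Rightarrow> 'a \<Rightarrow> 'a \<Rightarrow> real" where
  "kernel_dist K x y = K x x + K y y - 2 * K x y"

lemma kernel_dist_eliminate:
  assumes "psd_kernel X K" "range s \<subseteq> X"
  shows "kernel_dist K x y =
    (\<Sum>m<n. (cholesky_coord K s m x - cholesky_coord K s m y)\<^sup>2) + kernel_dist (eliminate K s n) x y"
proof -
  have "(\<Sum>m<n. (cholesky_coord K s m x - cholesky_coord K s m y)\<^sup>2) =
      (\<Sum>m<n. cholesky_coord K s m x * cholesky_coord K s m x) +
      (\<Sum>m<n. cholesky_coord K s m y * cholesky_coord K s m y) -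
      2 * (\<Sum>m<n. cholesky_coord K s m x * cholesky_coord K s m y)"
    unfolding sum_distrib_left sum.distrib[symmetric] sum_subtractf[symmetric]
    by (intro sum.cong refl) (simp add: power2_eq_square algebra_simps)
  then show ?thesis
    using eliminate_decomposition[OF assms, of x x n] eliminate_decomposition[OF assms, of y y n]
      eliminate_decomposition[OF assms, of x y n]
    by (simp add: kernel_dist_def)
qed

text \<open>Once \<open>s m\<close> is eliminated, its remaining vector is 0, so the remaining
  diagonal value at x is a squared distance to it. Elimination splits off squares and hence never
  increases squared distances.\<close>

lemma eliminate_diag_le:
  assumes K: "psd_kernel X K" and s: "range s \<subseteq> X" and "m < n" "x \<in> X"
  shows "eliminate K s n x x \<le> kernel_dist K x (s m)"
proof -
  have "kernel_dist (eliminate K s n) x (s m) = eliminate K s n x x"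
    using eliminate_vanishes[OF K s \<open>m < n\<close> \<open>x \<in> X\<close>]
      eliminate_vanishes[OF K s \<open>m < n\<close>, of "s m"] s by (auto simp: kernel_dist_def)
  moreover have "0 \<le> (\<Sum>i<n. (cholesky_coord K s i x - cholesky_coord K s i (s m))\<^sup>2)"
    by (intro sum_nonneg) simp
  ultimately show ?thesis
    using kernel_dist_eliminate[OF K s, of x "s m" n] by linarith
qed

text \<open>By polarisation this kernel is the inner product of \<open>i x - i q\<close> and
  \<open>i y - i q\<close> for any S-embedding i.\<close>

lemma psd_kernel_distance_kernel:
  assumes X: "quasihypermetric X" and q: "q \<in> X"
  shows "psd_kernel X (\<lambda>x y. (dist x q + dist y q - dist x y) / 2)"
  unfolding psd_kernel_def
proof (intro conjI ballI allI impI)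
  fix n :: nat and x and \<alpha> :: "nat \<Rightarrow> real" assume x: "\<forall>i<n. x i \<in> X"
  define A where "A = (\<Sum>i<n. \<alpha> i)"
  define L where "L = (\<Sum>i<n. \<alpha> i * dist (x i) q)"
  \<comment> \<open>The extra point q with weight -A brings the total mass to 0, as
    \<open>quasihypermetric\<close> requires; its diagonal term is
    \<open>dist q q = 0\<close>.\<close>
  have "(\<Sum>i<Suc n. \<Sum>j<Suc n. (\<alpha>(n := - A)) i * (\<alpha>(n := - A)) j * dist ((x(n := q)) i) ((x(n := q)) j)) \<le> 0"
    using X[unfolded quasihypermetric_def, rule_format, of "Suc n" "x(n := q)" "\<alpha>(n := - A)"] x q
    by (auto simp: A_def)
  then have "(\<Sum>i<n. \<Sum>j<n. \<alpha> i * \<alpha> j * dist (x i) (x j)) - 2 * A * L \<le> 0"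
    by (subst (asm) quadratic_form_add_point) (auto simp: dist_commute L_def)
  moreover have "(\<Sum>i<n. \<Sum>j<n. \<alpha> i * \<alpha> j * ((dist (x i) q + dist (x j) q - dist (x i) (x j)) / 2)) =
      (L * A + A * L - (\<Sum>i<n. \<Sum>j<n. \<alpha> i * \<alpha> j * dist (x i) (x j))) / 2"
    unfolding L_def A_def sum_product sum.distrib[symmetric] sum_subtractf[symmetric] sum_divide_distrib
    by (intro sum.cong refl) (simp add: algebra_simps)
  ultimately show "0 \<le> (\<Sum>i<n. \<Sum>j<n. \<alpha> i * \<alpha> j * ((dist (x i) q + dist (x j) q - dist (x i) (x j)) / 2))"
    by simp
qed (simp add: dist_commute)

text \<open>
  Schoenberg's theorem. The coordinates come from eliminating a dense sequence \<open>s\<close> from the kernel;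
  what remains of \<open>K x x\<close> after \<open>s m\<close> has been eliminated is at most \<open>dist x (s m)\<close>, hence tends to \<open>0\<close>.
\<close>

theorem ex_S_embedding:
  fixes X :: "'a::metric_space set"
  assumes ne: "X \<noteq> {}" and "compact X" and X: "quasihypermetric X"
  shows "\<exists>i. S_embedding X i"
proof -
  obtain q where q: "q \<in> X" using ne by blast
  obtain s :: "nat \<Rightarrow> 'a" where s: "range s \<subseteq> X" "X \<subseteq> closure (range s)"
  proof -
    obtain N P p where "compact_partition X N P p"
      using ex_compact_partition[OF \<open>compact X\<close>] by blast
    then interpret compact_partition X N P p .
    \<comment> \<open>The tags of all partitions form a countable set, dense because the mesh tends
      to 0. If D is finite, its enumeration repeats points, which zero pivots tolerate.\<close>
    define D where "D = (\<Union>k. p k ` {..<N k})"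
    have close: "\<exists>y\<in>D. dist y x < e" if x: "x \<in> X" and "e > 0" for x e
    proof -
      obtain k where k: "inverse (real (Suc k)) < e"
        using reals_Archimedean[OF \<open>e > 0\<close>] by blast
      obtain i where "i < N k" "x \<in> P k i"
        using x P_cover[of k] by blast
      then have "p k i \<in> D" "dist (p k i) x < e"
        using p_close[of i k x] k by (auto simp: D_def dist_commute)
      then show ?thesis by blast
    qed
    have "D \<noteq> {}"
      using close[OF q zero_less_one] by blast
    moreover have "countable D" "D \<subseteq> X"
      using p_in by (auto simp: D_def)
    moreover have "X \<subseteq> closure D"
      using close by (auto simp: closure_approachable)
    ultimately    show ?thesis
      using that[of "from_nat_into D"] by (simp add: range_from_nat_into)
  qed
  define K where "K x y = (dist x q + dist y q - dist x y) / 2" for x y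
  have K: "psd_kernel X K"
    unfolding K_def[abs_def] by (rule psd_kernel_distance_kernel[OF X q])
  have kd: "kernel_dist K x y = dist x y" for x y
    by (simp add: kernel_dist_def K_def field_simps)
  note psd = psd_kernel_eliminate[OF K s(1)]
  have lim0: "(\<lambda>n. eliminate K s n x x) \<longlonglongrightarrow> 0" if x: "x \<in> X" for x
  proof (rule LIMSEQ_I)
    fix e :: real assume "e > 0"
    then obtain m where m: "dist x (s m) < e"
      using s(2) x closure_approachable[of x "range s"] by (auto simp: dist_commute)
    have "norm (eliminate K s n x x - 0) < e" if "n \<ge> Suc m" for n
      using eliminate_diag_le[OF K s(1) _ x, of m n] psd_kernel_diag_nonneg[OF psd x, of n] m that
      by (simp add: kd)
    then show "\<exists>no. \<forall>n\<ge>no. norm (eliminate K s n x x - 0) < e" by blast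
  qed
  have sums: "(\<lambda>n. (cholesky_coord K s n x - cholesky_coord K s n y)\<^sup>2) sums dist x y"
    if x: "x \<in> X" and y: "y \<in> X" for x y
  proof -
    have "(\<lambda>n. kernel_dist (eliminate K s n) x y) \<longlonglongrightarrow> 0"
    \<comment> \<open>The form with coefficients (1, -1) gives the lower bound. With (1, 1) it gives
      the upper one, as in the parallelogram law.\<close>
    proof (rule real_tendsto_sandwich)
      show "\<forall>\<^sub>F n in sequentially. 0 \<le> kernel_dist (eliminate K s n) x y"
        using psd_kernel_two_points[OF psd x y, where a = 1 and b = "-1"]
        by (intro always_eventually allI) (simp add: kernel_dist_def algebra_simps)
      show "\<forall>\<^sub>F n in sequentially. kernel_dist (eliminate K s n) x y \<le>
          2 * eliminate K s n x x + 2 * eliminate K s n y y"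
        using psd_kernel_two_points[OF psd x y, where a = 1 and b = 1]
        by (intro always_eventually allI) (simp add: kernel_dist_def algebra_simps)
      show "(\<lambda>n. 2 * eliminate K s n x x + 2 * eliminate K s n y y) \<longlonglongrightarrow> 0"
        using tendsto_add[OF tendsto_mult_left[OF lim0[OF x], of 2] tendsto_mult_left[OF lim0[OF y], of 2]]
        by simp
    qed simp
    then have "(\<lambda>n. dist x y - kernel_dist (eliminate K s n) x y) \<longlonglongrightarrow> dist x y - 0"
      by (intro tendsto_intros)
    moreover have "dist x y - kernel_dist (eliminate K s n) x y =
        (\<Sum>m<n. (cholesky_coord K s m x - cholesky_coord K s m y)\<^sup>2)" for n
      using kernel_dist_eliminate[OF K s(1), of x y n] by (simp add: kd)
    ultimately show ?thesis
      by (simp add: sums_def)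
  qed
  \<comment> \<open>Relative to q, square summability of the coordinates is the instance of
    \<open>sums\<close> at x and q.\<close>
  define i where "i x = Abs_ell2 (\<lambda>n. cholesky_coord K s n x - cholesky_coord K s n q)" for x
  have Rep: "Rep_ell2 (i x) n = cholesky_coord K s n x - cholesky_coord K s n q" if "x \<in> X" for x n
    using sums_summable[OF sums[OF that q]] unfolding i_def by (subst Abs_ell2_inverse) auto
  have "(norm (i x - i y))\<^sup>2 = dist x y" if "x \<in> X" "y \<in> X" for x y
  proof -
    have "(norm (i x - i y))\<^sup>2 = (\<Sum>n. (Rep_ell2 (i x) n - Rep_ell2 (i y) n)\<^sup>2)"
      by (simp add: norm_ell2_eq minus_ell2.rep_eq)
    also have "\<dots> = dist x y"
      using sums_unique[OF sums[OF that]] that by (simp add: Rep)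
    finally show ?thesis .
  qed
  then show ?thesis
    unfolding S_embedding_def by blast
qed

section \<open>Maximising sequences and spheres\<close>

lemma sum_weighted_sq_dist:
  fixes w :: "'b::real_inner" and v :: "nat \<Rightarrow> 'b"
  shows "(\<Sum>i<n. \<alpha> i * (norm (w - v i))\<^sup>2) =
    (\<Sum>i<n. \<alpha> i) * (norm w)\<^sup>2 - 2 * (w \<bullet> (\<Sum>i<n. \<alpha> i *\<^sub>R v i)) + (\<Sum>i<n. \<alpha> i * (norm (v i))\<^sup>2)"
proof -
  have "\<alpha> i * (norm (w - v i))\<^sup>2 =
      \<alpha> i * (norm w)\<^sup>2 - 2 * (w \<bullet> (\<alpha> i *\<^sub>R v i)) + \<alpha> i * (norm (v i))\<^sup>2" for i
    by (simp add: power2_norm_eq_inner inner_diff inner_commute algebra_simps)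
  then show ?thesis
    by (simp add: sum.distrib sum_subtractf sum_distrib_right sum_distrib_left inner_sum_right)
qed

text \<open>For total mass 1, the points enter only through the barycentres and second moments; this
  yields both the sphere bound and the distances between barycentres.\<close>

lemma sum_weighted_pair_sq_dist:
  fixes v w :: "nat \<Rightarrow> 'b::real_inner"
  assumes "(\<Sum>i<n. \<alpha> i) = 1" "(\<Sum>j<m. \<beta> j) = 1"
  shows "(\<Sum>j<m. \<beta> j * (\<Sum>i<n. \<alpha> i * (norm (w j - v i))\<^sup>2)) =
    (\<Sum>j<m. \<beta> j * (norm (w j))\<^sup>2) -
    2 * ((\<Sum>j<m. \<beta> j *\<^sub>R w j) \<bullet> (\<Sum>i<n. \<alpha> i *\<^sub>R v i)) + (\<Sum>i<n. \<alpha> i * (norm (v i))\<^sup>2)"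
proof -
  define b where "b = (\<Sum>i<n. \<alpha> i *\<^sub>R v i)"
  define s where "s = (\<Sum>i<n. \<alpha> i * (norm (v i))\<^sup>2)"
  have "(\<Sum>j<m. \<beta> j * (\<Sum>i<n. \<alpha> i * (norm (w j - v i))\<^sup>2)) =
      (\<Sum>j<m. \<beta> j * (norm (w j))\<^sup>2 - 2 * ((\<beta> j *\<^sub>R w j) \<bullet> b) + \<beta> j * s)"
    unfolding sum_weighted_sq_dist assms b_def s_def by (simp add: algebra_simps)
  also have "\<dots> = (\<Sum>j<m. \<beta> j * (norm (w j))\<^sup>2) - 2 * ((\<Sum>j<m. \<beta> j *\<^sub>R w j) \<bullet> b) + (\<Sum>j<m. \<beta> j) * s"
    by (simp only: sum.distrib sum_subtractf sum_distrib_right sum_distrib_left inner_sum_left)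
  finally show ?thesis
    by (simp add: assms b_def s_def)
qed

lemma mass_measures_lin_comb:
  assumes "\<mu> \<in> mass_measures X s" "\<nu> \<in> mass_measures X t"
  shows "(\<lambda>A. a * \<mu> A + b * \<nu> A) \<in> mass_measures X (a * s + b * t)"
  using assms signed_measures_lin_comb[of \<mu> "borel_on X" \<nu> a b] by (simp add: mass_measures_def)

lemma mass_measures_diff:
  assumes "\<mu> \<in> mass_measures X s" "\<nu> \<in> mass_measures X t"
  shows "(\<lambda>A. \<mu> A - \<nu> A) \<in> mass_measures X (s - t)"
  using mass_measures_lin_comb[OF assms, of 1 "-1"] by simp

lemma mass_measures_signed: "\<mu> \<in> mass_measures X t \<Longrightarrow> \<mu> \<in> signed_measures (borel_on X)"
  by (simp add: mass_measures_def)

lemma max_energy_finite_iff: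
  "max_energy X < \<infinity> \<longleftrightarrow> (\<exists>C. \<forall>\<mu>\<in>mass_measures X 1. energy X \<mu> \<le> C)"
proof
  assume fin: "max_energy X < \<infinity>"
  have le: "ereal (energy X \<mu>) \<le> max_energy X" if "\<mu> \<in> mass_measures X 1" for \<mu>
    unfolding max_energy_def using that by (rule SUP_upper)
  show "\<exists>C. \<forall>\<mu>\<in>mass_measures X 1. energy X \<mu> \<le> C"
  proof (intro exI ballI)
    fix \<mu> assume "\<mu> \<in> mass_measures X 1"
    from le[OF this] fin show "energy X \<mu> \<le> real_of_ereal (max_energy X)"
      by (cases "max_energy X") auto
  qed
next
  assume "\<exists>C. \<forall>\<mu>\<in>mass_measures X 1. energy X \<mu> \<le> C"
  then obtain C where "\<forall>\<mu>\<in>mass_measures X 1. energy X \<mu> \<le> C" by blast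
  then have "max_energy X \<le> ereal C"
    unfolding max_energy_def by (intro SUP_least) auto
  then show "max_energy X < \<infinity>"
    by (rule order.strict_trans1) simp
qed

section \<open>Bounded energy against spheres and invariant sequences\<close>

context compact_partition
begin

text \<open>With the centre moved to 0, the second moment is \<open>r\<^sup>2\<close> for all
  weights of sum 1, negative ones included. The energy is then \<open>2 * r\<^sup>2\<close> minus
  twice the squared norm of the barycentre.\<close>

lemma energy_le_if_on_sphere:
  assumes i: "S_embedding X i" and sph: "i ` X \<subseteq> sphere z r" and \<mu>: "\<mu> \<in> mass_measures X 1"
  shows "energy X \<mu> \<le> 2 * r\<^sup>2"
proof (rule energy_le_if_finite_sums_le[OF _ \<mu>])
  fix n :: nat and x and \<alpha> :: "nat \<Rightarrow> real"
  assume x: "\<And>i. i < n \<Longrightarrow> x i \<in> X" and \<alpha>: "(\<Sum>i<n. \<alpha> i) = 1"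
  define v where "v j = i (x j) - z" for j
  have nv: "norm (v j) = r" if "j < n" for j
    using sph x[OF that] by (auto simp: v_def dist_norm norm_minus_commute)
  have "dist (x j) (x k) = (norm (v j - v k))\<^sup>2" if "j < n" "k < n" for j k
    using i x that by (simp add: S_embedding_def v_def)
  then have "(\<Sum>j<n. \<Sum>k<n. \<alpha> j * \<alpha> k * dist (x j) (x k)) =
      (\<Sum>j<n. \<alpha> j * (\<Sum>k<n. \<alpha> k * (norm (v j - v k))\<^sup>2))"
    by (simp add: sum_distrib_left mult.assoc)
  also have "\<dots> = 2 * (\<Sum>j<n. \<alpha> j * (norm (v j))\<^sup>2) -
      2 * ((\<Sum>j<n. \<alpha> j *\<^sub>R v j) \<bullet> (\<Sum>j<n. \<alpha> j *\<^sub>R v j))"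
    by (simp add: sum_weighted_pair_sq_dist[OF \<alpha> \<alpha>])
  also have "(\<Sum>j<n. \<alpha> j * (norm (v j))\<^sup>2) = r\<^sup>2"
    using \<alpha> by (simp add: nv sum_distrib_right[symmetric])
  finally show "(\<Sum>j<n. \<Sum>k<n. \<alpha> j * \<alpha> k * dist (x j) (x k)) \<le> 2 * r\<^sup>2"
    by simp
qed

text \<open>Integrating the constant c against a measure of mass 1 gives c again. The limit does not
  depend on \<nu>, so differences of two such mutual energies tend to 0.\<close>

lemma mutual_energy_tendsto_if_potential_tendsto:
  assumes \<mu>: "\<And>n. \<mu> n \<in> \<M>" and lim: "uniform_limit X (\<lambda>n. potential X (\<mu> n)) (\<lambda>_. c) sequentially"
    and \<nu>: "\<nu> \<in> mass_measures X 1"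
  shows "(\<lambda>n. mutual_energy X (\<mu> n) \<nu>) \<longlonglongrightarrow> c"
proof (rule tendstoI)
  fix e :: real assume "e > 0"
  define e' where "e' = e / (tv \<nu> + 1)"
  have "tv \<nu> + 1 > 0"
    using total_variation_nonneg[of "borel_on X" \<nu>] by simp
  then have e': "e' > 0" "e' * tv \<nu> < e"
    using \<open>e > 0\<close> by (auto simp: e'_def field_simps)
  have \<nu>': "\<nu> \<in> \<M>" "\<nu> X = 1"
    using \<nu> by (auto simp: mass_measures_def)
  from uniform_limitD[OF lim e'(1)]
  show "\<forall>\<^sub>F n in sequentially. dist (mutual_energy X (\<mu> n) \<nu>) c < e"
  proof eventually_elim
    case (elim n)
    obtain C where C: "potential X (\<mu> n) \<in> borel_measurable (borel_on X)"
      "\<And>x. x \<in> space (borel_on X) \<Longrightarrow> \<bar>potential X (\<mu> n) x\<bar> \<le> C"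
      using continuous_on_bounded_measurable[OF continuous_on_potential[OF \<mu>]] by blast
    have "mutual_energy X (\<mu> n) \<nu> - c =
        signed_integral (borel_on X) \<nu> (\<lambda>x. potential X (\<mu> n) x - c)"
      using signed_integral_diff[OF \<nu>'(1) C, of "\<lambda>_. c" "\<bar>c\<bar>"] \<nu>'
      by (simp add: signed_integral_const mutual_energy_def space_borel_on)
    also have "\<bar>\<dots>\<bar> \<le> e' * tv \<nu>"
      using elim C(1) by (intro abs_signed_integral_le[OF \<nu>'(1)])
        (auto simp: space_borel_on dist_real_def intro: less_imp_le)
    finally show ?case
      using e'(2) by (simp add: dist_real_def)
  qed
qed

text \<open>
  Negativity on differences gives \<open>I(\<nu>) \<le> 2 I(\<mu>\<^sub>n, \<nu>) - I(\<mu>\<^sub>n)\<close>, and the Cauchy condition bounds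
  \<open>I(\<mu>\<^sub>n)\<close> below by \<open>2 I(\<mu>\<^sub>n, \<mu>\<^sub>k) - I(\<mu>\<^sub>k) - 1\<close>; both mutual energies converge to the same constant.
\<close>

lemma energy_bounded_if_d_invariant:
  assumes X: "quasihypermetric X" and inv: "d_invariant_seq X \<mu>"
  shows "\<exists>C. \<forall>\<nu>\<in>mass_measures X 1. energy X \<nu> \<le> C"
proof -
  have \<mu>: "\<mu> n \<in> mass_measures X 1" for n
    using inv by (auto simp: d_invariant_seq_def)
  note \<mu>' = mass_measures_signed[OF \<mu>]
  obtain c where c: "uniform_limit X (\<lambda>n. potential X (\<mu> n)) (\<lambda>_. c) sequentially"
    using inv by (auto simp: d_invariant_seq_def)
  have "\<forall>\<^sub>F q in sequentially \<times>\<^sub>F sequentially.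
      dist ((\<lambda>(n, m). energy_seminorm X (\<lambda>A. \<mu> n A - \<mu> m A)) q) 0 < 1"
    using inv unfolding d_invariant_seq_def by (intro tendstoD) auto
  then obtain k where k: "\<And>n m. n \<ge> k \<Longrightarrow> m \<ge> k \<Longrightarrow> \<bar>energy_seminorm X (\<lambda>A. \<mu> n A - \<mu> m A)\<bar> < 1"
    unfolding eventually_prod_sequentially by auto
  have low: "- energy X (\<lambda>A. \<mu> n A - \<mu> k A) < 1" if "n \<ge> k" for n
    using le_less_trans[OF abs_ge_self k[OF that order_refl]] by (simp add: energy_seminorm_def)
  have "energy X \<nu> \<le> 1 + energy X (\<mu> k)" if \<nu>: "\<nu> \<in> mass_measures X 1" for \<nu>
  proof -
    note lims = mutual_energy_tendsto_if_potential_tendsto[OF \<mu>' c]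
    have "(\<lambda>n. 2 * mutual_energy X (\<mu> n) \<nu> - 2 * mutual_energy X (\<mu> n) (\<mu> k) + (1 + energy X (\<mu> k)))
        \<longlonglongrightarrow> 2 * c - 2 * c + (1 + energy X (\<mu> k))"
      by (intro tendsto_intros lims \<mu> \<nu>)
    moreover have "energy X \<nu> \<le>
        2 * mutual_energy X (\<mu> n) \<nu> - 2 * mutual_energy X (\<mu> n) (\<mu> k) + (1 + energy X (\<mu> k))"
      if "n \<ge> k" for n
    proof -
      have "energy X (\<lambda>A. \<mu> n A - \<nu> A) \<le> 0"
        using mass_measures_diff[OF \<mu>[of n] \<nu>] by (intro energy_mass_zero_nonpos[OF X]) simp
      then show ?thesis
        using low[OF that] energy_diff[OF \<mu>' mass_measures_signed[OF \<nu>], of n]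
          energy_diff[OF \<mu>' \<mu>', of n k]
        by linarith
    qed
    ultimately have "energy X \<nu> \<le> 2 * c - 2 * c + (1 + energy X (\<mu> k))"
      by (intro LIMSEQ_le_const) auto
    then show ?thesis by simp
  qed
  then show ?thesis by blast
qed

text \<open>A competitor of zero energy whose mutual energy with \<mu> reads off the potential at
  one point.\<close>

lemma dirac:
  assumes "x \<in> X"
  obtains \<delta> where "\<delta> \<in> mass_measures X 1" "energy X \<delta> = 0"
    "\<And>\<mu>. \<mu> \<in> \<M> \<Longrightarrow> mutual_energy X \<mu> \<delta> = potential X \<mu> x"
proof
  show "point_masses X 1 (\<lambda>_. x) (\<lambda>_. 1) \<in> mass_measures X 1"
    using point_masses_mass[of 1 "\<lambda>_. x" X "\<lambda>_. 1"] assms by simp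
  show "energy X (point_masses X 1 (\<lambda>_. x) (\<lambda>_. 1)) = 0"
    using assms by (subst energy_point_masses) auto
  show "mutual_energy X \<mu> (point_masses X 1 (\<lambda>_. x) (\<lambda>_. 1)) = potential X \<mu> x" if "\<mu> \<in> \<M>" for \<mu>
    using assms that by (subst mutual_energy_point_masses) auto
qed

text \<open>
  Move a near-maximiser towards a point mass. The discriminant of the resulting quadratic
  inequality in the step size shows that its potential is nearly constant.
\<close>

lemma potential_near_maximum:
  assumes X: "quasihypermetric X" and max: "\<And>\<nu>. \<nu> \<in> mass_measures X 1 \<Longrightarrow> energy X \<nu> \<le> M"
    and \<mu>: "\<mu> \<in> mass_measures X 1" and x: "x \<in> X"
  defines "e \<equiv> M - energy X \<mu>"
  shows "\<bar>potential X \<mu> x - M\<bar> \<le> 2 * e + sqrt (e\<^sup>2 + e * M)"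
proof -
  obtain \<delta> where \<delta>: "\<delta> \<in> mass_measures X 1" "energy X \<delta> = 0"
    "mutual_energy X \<mu> \<delta> = potential X \<mu> x"
    using dirac[OF x] mass_measures_signed[OF \<mu>] by metis
  note s = mass_measures_signed[OF \<mu>] mass_measures_signed[OF \<delta>(1)]
  \<comment> \<open>Along \<open>(1 - t) * \<mu> + t * \<delta>\<close> the energy is
    \<open>energy X \<mu> + 2 * t * u - t\<^sup>2 * q\<close>, and -q is the energy of the
    difference of \<mu> and \<delta>.\<close>
  define u where "u = potential X \<mu> x - energy X \<mu>"
  define q where "q = 2 * u + energy X \<mu>"
  have e0: "e \<ge> 0" using max[OF \<mu>] by (simp add: e_def)
  have "energy X (\<lambda>A. \<mu> A - \<delta> A) \<le> 0"
    using mass_measures_diff[OF \<mu> \<delta>(1)] by (intro energy_mass_zero_nonpos[OF X]) simp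
  then have q0: "q \<ge> 0"
    using energy_diff[OF s] \<delta> by (simp add: q_def u_def)
  have t: "2 * t * u - t\<^sup>2 * q \<le> e" for t
  proof -
    have "(\<lambda>A. (1 - t) * \<mu> A + t * \<delta> A) \<in> mass_measures X 1"
      using mass_measures_lin_comb[OF \<mu> \<delta>(1), of "1 - t" t] by simp
    from max[OF this] have "(1 - t)\<^sup>2 * energy X \<mu> + 2 * (1 - t) * t * potential X \<mu> x \<le> M"
      using energy_lin_comb[OF s, of "1 - t" t] \<delta> by simp
    then show ?thesis
      by (simp add: e_def q_def u_def power2_eq_square algebra_simps)
  qed
  have u2: "u\<^sup>2 \<le> e * q"
  proof (cases "q = 0")
    case True
    have "u = 0"
    proof (rule ccontr)
      assume "u \<noteq> 0"
      then have "2 * ((e + 1) / (2 * u)) * u = e + 1" by simp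
      then show False using t[of "(e + 1) / (2 * u)"] True by simp
    qed
    then show ?thesis using True by simp
  next
    case False
    then have "q > 0" using q0 by simp
    \<comment> \<open>The step size u / q maximises the left side of \<open>t\<close>.\<close>
    have "2 * (u / q) * u - (u / q)\<^sup>2 * q = u\<^sup>2 / q"
      using False by (simp add: field_simps power2_eq_square)
    then have "u\<^sup>2 / q \<le> e"
      using t[of "u / q"] by simp
    then show ?thesis
      using \<open>q > 0\<close> by (simp add: field_simps)
  qed
  also have "e * q \<le> e * (2 * \<bar>u\<bar> + M)"
    using e0 max[OF \<mu>] by (intro mult_left_mono) (auto simp: q_def)
  \<comment> \<open>Completing the square in \<open>\<bar>u\<bar>\<close>. Since
    \<open>potential X \<mu> x - M = u - e\<close>, the triangle inequality adds another e, whence 2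
    * e in the bound.\<close>
  finally have "(\<bar>u\<bar> - e)\<^sup>2 \<le> e\<^sup>2 + e * M"
    by (simp add: power2_diff algebra_simps)
  then have "\<bar>u\<bar> - e \<le> sqrt (e\<^sup>2 + e * M)"
    by (rule real_le_rsqrt)
  then show ?thesis
    using e0 by (simp add: u_def e_def)
qed

text \<open>Parallelogram law: the left side is 4 times the energy of the midpoint minus twice both
  energies, and the midpoint again has mass 1.\<close>

lemma energy_diff_near_maximum:
  assumes max: "\<And>\<nu>. \<nu> \<in> mass_measures X 1 \<Longrightarrow> energy X \<nu> \<le> M"
    and \<mu>: "\<mu> \<in> mass_measures X 1" and \<nu>: "\<nu> \<in> mass_measures X 1"
  shows "- energy X (\<lambda>A. \<mu> A - \<nu> A) \<le> 2 * (M - energy X \<mu>) + 2 * (M - energy X \<nu>)"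
proof -
  note s = mass_measures_signed[OF \<mu>] mass_measures_signed[OF \<nu>]
  have "(\<lambda>A. (1/2) * \<mu> A + (1/2) * \<nu> A) \<in> mass_measures X 1"
    using mass_measures_lin_comb[OF \<mu> \<nu>, of "1/2" "1/2"] by simp
  from max[OF this] show ?thesis
    unfolding energy_lin_comb[OF s] energy_diff[OF s] by (simp add: power2_eq_square)
qed

text \<open>Energies and potentials share the limit M; this common value later fixes the radius of
  the sphere.\<close>

lemma ex_maximising_point_masses:
  assumes ne: "X \<noteq> {}" and X: "quasihypermetric X"
    and bdd: "\<forall>\<mu>\<in>mass_measures X 1. energy X \<mu> \<le> C"
  obtains n x \<alpha> M where "\<And>k i. i < n k \<Longrightarrow> x k i \<in> X" "\<And>k. (\<Sum>i<n k. \<alpha> k i) = 1"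
    "d_invariant_seq X (\<lambda>k. point_masses X (n k) (x k) (\<alpha> k))"
    "(\<lambda>k. energy X (point_masses X (n k) (x k) (\<alpha> k))) \<longlonglongrightarrow> M"
    "\<And>z. z \<in> X \<Longrightarrow> (\<lambda>k. potential X (point_masses X (n k) (x k) (\<alpha> k)) z) \<longlonglongrightarrow> M"
proof -
  define M where "M = Sup (energy X ` mass_measures X 1)"
  have max: "energy X \<nu> \<le> M" if "\<nu> \<in> mass_measures X 1" for \<nu>
    unfolding M_def using that bdd by (intro cSup_upper) (auto simp: bdd_above_def)
  obtain z where z: "z \<in> X" using ne by blast
  have ne1: "mass_measures X 1 \<noteq> {}"
    using dirac[OF z] by blast
  have "\<exists>n x \<alpha>. (\<forall>i<n. x i \<in> X) \<and> (\<Sum>i<n. \<alpha> i) = 1 \<and>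
      M - energy X (point_masses X n x \<alpha>) < inverse (real (Suc k))" for k
  proof -
    have "M - inverse (real (Suc k)) < M" by simp
    then obtain \<mu> where \<mu>: "\<mu> \<in> mass_measures X 1" "M - inverse (real (Suc k)) < energy X \<mu>"
      unfolding M_def using less_cSupD[of "energy X ` mass_measures X 1"] ne1 by blast
    \<comment> \<open>The strict lower bound survives discretisation, so a finite configuration is
      as near to the supremum as \<mu>.\<close>
    have "(\<lambda>l. discrete_energy l \<mu> \<mu>) \<longlonglongrightarrow> energy X \<mu>"
      unfolding energy_eq_mutual_energy by (intro discrete_energy_tendsto mass_measures_signed[OF \<mu>(1)])
    from order_tendstoD(1)[OF this \<mu>(2)] obtain l where "M - inverse (real (Suc k)) < discrete_energy l \<mu> \<mu>"
      by (auto simp: eventually_sequentially)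
    moreover have "energy X (point_masses X (N l) (p l) (\<lambda>i. \<mu> (P l i))) = discrete_energy l \<mu> \<mu>"
      using p_in by (subst energy_point_masses) (auto simp: discrete_energy_def)
    ultimately show ?thesis
      using p_in sum_cells[OF \<mu>(1), of l]
      by (intro exI[of _ "N l"] exI[of _ "p l"] exI[of _ "\<lambda>i. \<mu> (P l i)"] conjI) auto
  qed
  then obtain n x \<alpha> where seq: "\<And>k i. i < n k \<Longrightarrow> x k i \<in> X" "\<And>k. (\<Sum>i<n k. \<alpha> k i) = 1"
    "\<And>k. M - energy X (point_masses X (n k) (x k) (\<alpha> k)) < inverse (real (Suc k))"
    by metis
  define \<mu> where "\<mu> k = point_masses X (n k) (x k) (\<alpha> k)" for k
  have \<mu>: "\<mu> k \<in> mass_measures X 1" for k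
    using point_masses_mass[of "n k" "x k" X "\<alpha> k"] seq by (simp add: \<mu>_def)
  define e where "e k = M - energy X (\<mu> k)" for k
  have e: "0 \<le> e k" "e k < inverse (real (Suc k))" for k
    using max[OF \<mu>] seq(3) by (auto simp: e_def \<mu>_def)
  have e_lim: "e \<longlonglongrightarrow> 0"
    by (rule real_tendsto_sandwich[OF _ _ tendsto_const LIMSEQ_inverse_real_of_nat])
       (use e in \<open>auto intro!: always_eventually less_imp_le simp del: of_nat_Suc\<close>)
  have "(\<lambda>k. M - e k) \<longlonglongrightarrow> M - 0"
    by (intro tendsto_intros e_lim)
  then have energy_lim: "(\<lambda>k. energy X (\<mu> k)) \<longlonglongrightarrow> M"
    by (simp add: e_def)
  have "(\<lambda>k. 2 * e k + sqrt ((e k)\<^sup>2 + e k * M)) \<longlonglongrightarrow> 2 * 0 + sqrt (0\<^sup>2 + 0 * M)"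
    by (intro tendsto_intros e_lim)
  then have g_lim: "(\<lambda>k. 2 * e k + sqrt ((e k)\<^sup>2 + e k * M)) \<longlonglongrightarrow> 0"
    by simp
  have pot: "uniform_limit X (\<lambda>k. potential X (\<mu> k)) (\<lambda>_. M) sequentially"
  proof (rule uniform_limitI)
    fix d :: real assume "d > 0"
    from order_tendstoD(2)[OF g_lim this]
    show "\<forall>\<^sub>F k in sequentially. \<forall>x\<in>X. dist (potential X (\<mu> k) x) M < d"
    proof eventually_elim
      case (elim k)
      then show ?case
        using potential_near_maximum[OF X max \<mu>[of k], folded e_def] unfolding dist_real_def
        by (blast intro: le_less_trans)
    qed
  qed
  have cauchy: "((\<lambda>(k, l). energy_seminorm X (\<lambda>A. \<mu> k A - \<mu> l A)) \<longlongrightarrow> 0)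
      (sequentially \<times>\<^sub>F sequentially)"
  proof (rule tendstoI)
    fix d :: real assume d: "d > 0"
    then have "d\<^sup>2 / 4 > 0" by simp
    from order_tendstoD(2)[OF e_lim this] obtain K where K: "\<And>k. k \<ge> K \<Longrightarrow> e k < d\<^sup>2 / 4"
      by (auto simp: eventually_sequentially)
    have "\<bar>energy_seminorm X (\<lambda>A. \<mu> k A - \<mu> l A)\<bar> < d" if "k \<ge> K" "l \<ge> K" for k l
    proof -
      have "- energy X (\<lambda>A. \<mu> k A - \<mu> l A) \<le> 2 * e k + 2 * e l"
        unfolding e_def by (rule energy_diff_near_maximum[OF max \<mu> \<mu>])
      also have "\<dots> < d\<^sup>2"
        using K[OF that(1)] K[OF that(2)] by simp
      finally have "- energy X (\<lambda>A. \<mu> k A - \<mu> l A) < d\<^sup>2" .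
      moreover have "0 \<le> - energy X (\<lambda>A. \<mu> k A - \<mu> l A)"
        using energy_mass_zero_nonpos[OF X, of "\<lambda>A. \<mu> k A - \<mu> l A"] mass_measures_diff[OF \<mu> \<mu>, of k l]
        by simp
      ultimately show ?thesis
        unfolding energy_seminorm_def using d by (simp add: real_less_lsqrt)
    qed
    then show "\<forall>\<^sub>F q in sequentially \<times>\<^sub>F sequentially.
        dist ((\<lambda>(k, l). energy_seminorm X (\<lambda>A. \<mu> k A - \<mu> l A)) q) 0 < d"
      unfolding eventually_prod_sequentially by auto
  qed
  have "d_invariant_seq X \<mu>"
    unfolding d_invariant_seq_def using \<mu> pot cauchy by blast
  with that[of n x \<alpha> M] seq(1,2) energy_lim tendsto_uniform_limitI[OF pot] show ?thesis
    unfolding \<mu>_def by blast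
qed

text \<open>
  An S-embedding \<open>i\<close> turns energies into distances: a finite configuration \<open>\<mu>\<close> of mass \<open>1\<close> with
  barycentre \<open>b\<close> satisfies \<open>(norm (i z - b))\<^sup>2 = d\<^sub>\<mu>(z) - I(\<mu>) / 2\<close>, and the seminorm of a difference
  is \<open>sqrt 2\<close> times the distance of the barycentres.
\<close>

lemma lies_on_sphere_if_energy_bounded:
  assumes ne: "X \<noteq> {}" and X: "quasihypermetric X"
    and bdd: "\<forall>\<mu>\<in>mass_measures X 1. energy X \<mu> \<le> C" and i: "S_embedding X i"
  shows "lies_on_sphere X i"
proof (rule ex_maximising_point_masses[OF ne X bdd])
  fix n x \<alpha> M
  assume x: "\<And>k j. j < n k \<Longrightarrow> x k j \<in> X" and \<alpha>: "\<And>k. (\<Sum>j<n k. \<alpha> k j) = 1"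
    and inv: "d_invariant_seq X (\<lambda>k. point_masses X (n k) (x k) (\<alpha> k))"
    and en: "(\<lambda>k. energy X (point_masses X (n k) (x k) (\<alpha> k))) \<longlonglongrightarrow> M"
    and pot: "\<And>z. z \<in> X \<Longrightarrow> (\<lambda>k. potential X (point_masses X (n k) (x k) (\<alpha> k)) z) \<longlonglongrightarrow> M"
  define \<mu> where "\<mu> k = point_masses X (n k) (x k) (\<alpha> k)" for k
  have \<mu>: "\<mu> k \<in> \<M>" for k
    unfolding \<mu>_def by (rule point_masses_signed)
  define b where "b k = (\<Sum>j<n k. \<alpha> k j *\<^sub>R i (x k j))" for k
  define s where "s k = (\<Sum>j<n k. \<alpha> k j * (norm (i (x k j)))\<^sup>2)" for k
  have d: "dist y z = (norm (i y - i z))\<^sup>2" if "y \<in> X" "z \<in> X" for y z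
    using i that by (simp add: S_embedding_def)
  have P1: "potential X (\<mu> k) z = (\<Sum>j<n k. \<alpha> k j * (norm (i z - i (x k j)))\<^sup>2)" if "z \<in> X" for k z
    unfolding \<mu>_def using x that by (subst potential_point_masses) (auto intro!: sum.cong simp: d)
  have P2: "potential X (\<mu> k) z = (norm (i z))\<^sup>2 - 2 * (i z \<bullet> b k) + s k" if "z \<in> X" for k z
    unfolding P1[OF that] sum_weighted_sq_dist \<alpha> b_def s_def by simp
  have E: "mutual_energy X (\<mu> k) (\<mu> l) = s l - 2 * (b l \<bullet> b k) + s k" for k l
  proof -
    have "mutual_energy X (\<mu> k) (\<mu> l) = (\<Sum>j<n l. \<alpha> l j * potential X (\<mu> k) (x l j))"
      unfolding \<mu>_def[of l] using x by (intro mutual_energy_point_masses \<mu>) auto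
    also have "\<dots> = (\<Sum>j<n l. \<alpha> l j * (\<Sum>m<n k. \<alpha> k m * (norm (i (x l j) - i (x k m)))\<^sup>2))"
      using x by (intro sum.cong) (auto simp: P1)
    also have "\<dots> = s l - 2 * (b l \<bullet> b k) + s k"
      unfolding b_def s_def by (rule sum_weighted_pair_sq_dist[OF \<alpha> \<alpha>])
    finally show ?thesis .
  qed
  have diff: "- energy X (\<lambda>A. \<mu> k A - \<mu> l A) = 2 * (norm (b k - b l))\<^sup>2" for k l
    unfolding energy_diff[OF \<mu> \<mu>] unfolding energy_eq_mutual_energy E
    by (simp add: power2_norm_eq_inner inner_diff inner_commute algebra_simps)
  have "Cauchy b"
  proof (rule CauchyI)
    fix e :: real assume "e > 0"
    then have "\<forall>\<^sub>F q in sequentially \<times>\<^sub>F sequentially.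
        dist ((\<lambda>(k, l). energy_seminorm X (\<lambda>A. \<mu> k A - \<mu> l A)) q) 0 < e"
      using inv unfolding d_invariant_seq_def \<mu>_def[symmetric] by (intro tendstoD) auto
    then obtain K where K: "\<And>k l. k \<ge> K \<Longrightarrow> l \<ge> K \<Longrightarrow> \<bar>energy_seminorm X (\<lambda>A. \<mu> k A - \<mu> l A)\<bar> < e"
      unfolding eventually_prod_sequentially by auto
    have "norm (b k - b l) \<le> energy_seminorm X (\<lambda>A. \<mu> k A - \<mu> l A)" for k l
      unfolding energy_seminorm_def diff by (rule real_le_rsqrt) simp
    then show "\<exists>K. \<forall>k\<ge>K. \<forall>l\<ge>K. norm (b k - b l) < e"
      using K by (meson abs_less_iff le_less_trans)
  qed
  then obtain c where c: "b \<longlonglongrightarrow> c"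
    using Cauchy_convergent convergent_def by blast
  \<comment> \<open>The potential at z tends to M and half the energy to M / 2, so the squared
    distance to the barycentres has a limit independent of z.\<close>
  have "(norm (i z - c))\<^sup>2 = M / 2" if z: "z \<in> X" for z
  proof (rule LIMSEQ_unique)
    show "(\<lambda>k. (norm (i z - b k))\<^sup>2) \<longlonglongrightarrow> (norm (i z - c))\<^sup>2"
      by (intro tendsto_intros c)
    have "(norm (i z - b k))\<^sup>2 = potential X (\<mu> k) z - energy X (\<mu> k) / 2" for k
      unfolding P2[OF z] energy_eq_mutual_energy E
      by (simp add: power2_norm_eq_inner inner_diff inner_commute field_simps)
    moreover have "(\<lambda>k. potential X (\<mu> k) z - energy X (\<mu> k) / 2) \<longlonglongrightarrow> M - M / 2"
      using en pot[OF z] unfolding \<mu>_def by (intro tendsto_intros) auto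
    ultimately show "(\<lambda>k. (norm (i z - b k))\<^sup>2) \<longlonglongrightarrow> M / 2"
      by simp
  qed
  then have r: "norm (i z - c) = sqrt (M / 2)" if "z \<in> X" for z
    using that by (metis norm_ge_zero real_sqrt_unique)
  then have "i ` X \<subseteq> sphere c (sqrt (M / 2))"
    by (auto simp: dist_norm norm_minus_commute)
  moreover have "0 \<le> sqrt (M / 2)"
    using ne r by (metis ex_in_conv norm_ge_zero)
  ultimately show ?thesis
    unfolding lies_on_sphere_def by blast
qed

end

theorem theorem4p9:
  fixes X :: "'a::metric_space set"
  assumes "X \<noteq> {}" and "compact X" and "quasihypermetric X"
  shows "(max_energy X < \<infinity> \<longleftrightarrow> (\<exists>\<mu>. d_invariant_seq X \<mu>)) \<and>
    ((\<exists>\<mu>. d_invariant_seq X \<mu>) \<longleftrightarrow> (\<exists>i. S_embedding X i \<and> lies_on_sphere X i)) \<and>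
    ((\<exists>i. S_embedding X i \<and> lies_on_sphere X i) \<longleftrightarrow>
      (\<forall>i. S_embedding X i \<longrightarrow> lies_on_sphere X i))"
proof -
  obtain N P p where "compact_partition X N P p"
    using ex_compact_partition[OF \<open>compact X\<close>] by blast
  then interpret compact_partition X N P p .
  \<comment> \<open>The hub of the equivalence: one embedding on a sphere gives the bound, and the
    bound puts every embedding on a sphere.\<close>
  let ?bounded = "\<exists>C. \<forall>\<mu>\<in>mass_measures X 1. energy X \<mu> \<le> C"
  have "?bounded \<longleftrightarrow> (\<exists>\<mu>. d_invariant_seq X \<mu>)"
    using energy_bounded_if_d_invariant[OF assms(3)] ex_maximising_point_masses[OF assms(1,3)]
    by metis
  moreover have "?bounded \<Longrightarrow> S_embedding X i \<Longrightarrow> lies_on_sphere X i" for i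
    using lies_on_sphere_if_energy_bounded[OF assms(1,3)] by blast
  moreover have "?bounded" if "S_embedding X i" "lies_on_sphere X i" for i
    using energy_le_if_on_sphere[OF that(1)] that(2) unfolding lies_on_sphere_def by blast
  \<comment> \<open>This keeps the universal condition from holding vacuously, so that it implies
    the existential one.\<close>
  moreover have "\<exists>i. S_embedding X i"
    by (rule ex_S_embedding[OF assms])
  ultimately show ?thesis
    unfolding max_energy_finite_iff by blast
qed

end
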